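(* Let $(p_l)_{l\ge1}$ be a strictly increasing sequence of positive integers. For each $l\ge1$, let $(q_{j,l})_{j=0,\dots,r_l}$ be a strictly increasing finite sequence of integers with $q_{0,l}=1$ (where $r_l\ge0$ is an integer), and set $q_l=q_{0,l}+q_{1,l}+\cdots+q_{r_l,l}$. Suppose that $p_{l+1}>q_{r_l,l}\,p_l$ for each $l\ge1$, and that the series $$\sum_{l\ge1}\Bigl(\frac{q_l\,p_l}{p_{l+1}}\Bigr)^2$$ is convergent. Let $(n_k)_{k\ge1}$ be the strictly increasing sequence defined by $$\{n_k : k\ge 1\}=\bigcup_{l\ge1}\{p_l,\,q_{1,l}\,p_l,\,\dots,\,q_{r_l,l}\,p_l\}.$$ Then there exists a continuous generalized Riesz product $\sigma$ on $\mathbb{T}$ which is IP-Dirichlet with respect to the sequence $(n_k)_{k\ge1}$.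
   Context: $\mathbb{T}=\{\lambda\in\mathbb{C}: |\lambda|=1\}$. For a Borel probability measure $\mu$ on $\mathbb{T}$ and $n\in\mathbb{Z}$, $\hat\mu(n)=\int_{\mathbb{T}}\lambda^n\,d\mu(\lambda)$. A measure is continuous if it has no atoms. Let $\mathcal{F}$ be the set of all non-empty finite subsets of $\mathbb{N}=\{1,2,\dots\}$. A probability measure $\mu$ on $\mathbb{T}$ is IP-Dirichlet with respect to $(n_k)_{k\ge1}$ if $\hat\mu(\sum_{k\in F}n_k)\to 1$ as $\min(F)\to+\infty$, $F\in\mathcal{F}$; that is, for every $\varepsilon>0$ there exists $k_0$ such that $|\hat\mu(\sum_{k\in F}n_k)-1|<\varepsilon$ for every $F\in\mathcal{F}$ with $\min(F)\ge k_0$. A generalized Riesz product on $\mathbb{T}$ is a probability measure that is the weak-$*$ limit, as $N\to+\infty$, of the measures $\prod_{k=1}^N P_k(\lambda^{a_k})\,dm(\lambda)$, where $m$ is the normalized Lebesgue measure on $\mathbb{T}$, each $P_k$ is a trigonometric polynomial of degree $d_k$ (spectrum contained in $\{-d_k,\dots,d_k\}$) which is nonnegative on $\mathbb{T}$ and has constant Fourier coefficient $\hat P_k(0)=1$, and $(a_k)_{k\ge1}$ is a strictly increasing sequence of positive integers satisfying the dissociation condition $a_{k+1}-2\sum_{j=1}^k d_ja_j\ge 1$ for each $k\ge1$. *)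

theory Defs
  imports "HOL-Probability.Probability"
begin

abbreviation unit_circle :: "complex set" where
  "unit_circle \<equiv> sphere 0 1"

abbreviation borel_circle :: "complex measure" where
  "borel_circle \<equiv> restrict_space borel unit_circle"

definition circle_prob :: "complex measure \<Rightarrow> bool" where
  "circle_prob M \<longleftrightarrow> prob_space M \<and> sets M = sets borel_circle"

definition circle_lebesgue :: "complex measure" where
  "circle_lebesgue =
     distr (uniform_measure lborel {0..<1}) borel_circle (\<lambda>t. cis (2 * pi * t))"

text \<open>The convention is \<open>\<lambda>\<^sup>n\<close>, not \<open>\<lambda>\<close> to the power \<open>-n\<close>.\<close>

definition fourier_coeff :: "complex measure \<Rightarrow> int \<Rightarrow> complex" where
  "fourier_coeff M n = (\<integral>z. z powi n \<partial>M)"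

definition continuous_measure :: "complex measure \<Rightarrow> bool" where
  "continuous_measure M \<longleftrightarrow> (\<forall>z\<in>unit_circle. emeasure M {z} = 0)"

text \<open>All sequences below are indexed by the positive integers; the value at index \<open>0\<close> is
  never used.\<close>

definition ip_dirichlet :: "complex measure \<Rightarrow> (nat \<Rightarrow> int) \<Rightarrow> bool" where
  "ip_dirichlet M n \<longleftrightarrow> circle_prob M \<and>
     (\<forall>\<epsilon>>0. \<exists>k\<^sub>0. \<forall>F. finite F \<and> F \<noteq> {} \<and> F \<subseteq> {1..} \<and> k\<^sub>0 \<le> Min F \<longrightarrow>
        norm (fourier_coeff M (\<Sum>k\<in>F. n k) - 1) < \<epsilon>)"

definition weak_star_limit :: "(nat \<Rightarrow> complex measure) \<Rightarrow> complex measure \<Rightarrow> bool" where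
  "weak_star_limit \<mu> M \<longleftrightarrow>
     (\<forall>f :: complex \<Rightarrow> complex. continuous_on unit_circle f \<longrightarrow>
        (\<lambda>N. \<integral>z. f z \<partial>(\<mu> N)) \<longlonglongrightarrow> (\<integral>z. f z \<partial>M))"

text \<open>Real-valued trigonometric polynomials on the circle; \<open>d\<close> only bounds the spectrum, so the
  coefficients of index \<open>d\<close> and \<open>-d\<close> may vanish.\<close>

definition trig_poly :: "nat \<Rightarrow> (complex \<Rightarrow> real) \<Rightarrow> bool" where
  "trig_poly d P \<longleftrightarrow>
     (\<exists>c :: int \<Rightarrow> complex. \<forall>z\<in>unit_circle.
        complex_of_real (P z) = (\<Sum>n = - int d..int d. c n * z powi n))"

text \<open>The condition \<open>(\<integral>z. P k z \<partial>circle_lebesgue) = 1\<close> says that the constant Fourier coefficient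
  of \<open>P k\<close> is \<open>1\<close>.\<close>

definition generalized_riesz_product :: "complex measure \<Rightarrow> bool" where
  "generalized_riesz_product M \<longleftrightarrow> circle_prob M \<and>
     (\<exists>(P :: nat \<Rightarrow> complex \<Rightarrow> real) (d :: nat \<Rightarrow> nat) (a :: nat \<Rightarrow> nat).
        (\<forall>k\<ge>1. trig_poly (d k) (P k) \<and> (\<forall>z\<in>unit_circle. 0 \<le> P k z) \<and>
               (\<integral>z. P k z \<partial>circle_lebesgue) = 1) \<and>
        strict_mono_on {1..} a \<and> (\<forall>k\<ge>1. 0 < a k) \<and>
        (\<forall>k\<ge>1. int (a (k + 1)) - 2 * (\<Sum>j=1..k. int (d j) * int (a j)) \<ge> 1) \<and>
        weak_star_limit
          (\<lambda>N. density circle_lebesgue (\<lambda>z. ennreal (\<Prod>k=1..N. P k (z ^ a k)))) M)"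

end

theory Submission
  imports Defs
begin

text \<open>The measure is the Riesz product of the kernels \<open>P\<^sub>k(z) = |\<Sum>\<^sub>j u\<^sub>j z\<^sup>j|\<^sup>2 / \<Sum>\<^sub>j u\<^sub>j\<^sup>2\<close>, where
  \<open>u\<close> is a tent of half-width comparable to \<open>p\<^bsub>k+1\<^esub> / p\<^sub>k\<close>, placed at the frequencies \<open>p\<^sub>k\<close> with
  \<open>k\<close> large. The \<open>s\<close>-th Fourier coefficient of \<open>P\<^sub>k\<close> lies in \<open>[0, 1]\<close> and differs from \<open>1\<close> by
  \<open>O((s p\<^sub>k / p\<^bsub>k+1\<^esub>)\<^sup>2)\<close>. A finite sum of terms of \<open>n\<close> is \<open>\<Sum>\<^sub>k s\<^sub>k p\<^sub>k\<close> with \<open>0 \<le> s\<^sub>k \<le> q\<^sub>k\<close>, and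
  dissociation factors its Fourier coefficient as the product of the \<open>s\<^sub>k\<close>-th coefficients of the
  \<open>P\<^sub>k\<close>, so it is within a tail of the given convergent series (up to a constant) of \<open>1\<close>. The
  degrees are small enough to leave gaps in the spectrum around the integers
  \<open>\<lfloor>p\<^sub>k / 2\<rfloor>\<close>; the corresponding characters are orthogonal in \<open>L\<^sup>2(\<sigma>)\<close>, which excludes
  atoms.\<close>

section \<open>Integration on the circle\<close>

lemma measurable_on_circle:
  fixes f :: "complex \<Rightarrow> 'a::topological_space"
  assumes "continuous_on unit_circle f" "sets M = sets borel_circle"
  shows "f \<in> borel_measurable M"
  using borel_measurable_continuous_on_restrict[OF assms(1)] measurable_cong_sets[OF assms(2) refl]
  by blast

lemma circle_prob_space:
  assumes "circle_prob M" shows "space M = unit_circle"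
  using assms sets_eq_imp_space_eq[of M borel_circle]
  by (auto simp: circle_prob_def space_restrict_space)

lemma continuous_on_circle_bounded:
  fixes f :: "complex \<Rightarrow> 'a::real_normed_vector"
  assumes "continuous_on unit_circle f"
  obtains B where "B > 0" "\<And>z. z \<in> unit_circle \<Longrightarrow> norm (f z) \<le> B"
proof -
  have "compact (f ` unit_circle)"
    using assms by (intro compact_continuous_image) auto
  then show ?thesis
    using compact_imp_bounded bounded_pos that by (metis imageI)
qed

lemma integrable_on_circle:
  fixes f :: "complex \<Rightarrow> 'a::{banach,second_countable_topology}"
  assumes "circle_prob M" "continuous_on unit_circle f"
  shows "integrable M f"
proof -
  interpret prob_space M using assms(1) by (simp add: circle_prob_def)
  obtain B where "\<And>z. z \<in> unit_circle \<Longrightarrow> norm (f z) \<le> B"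
    using continuous_on_circle_bounded[OF assms(2)] by blast
  then show ?thesis
    using assms circle_prob_space[OF assms(1)]
    by (intro integrable_const_bound[where B=B] measurable_on_circle AE_I2)
       (auto simp: circle_prob_def)
qed

lemma norm_integral_diff_le_on_circle:
  fixes f g :: "complex \<Rightarrow> complex"
  assumes M: "circle_prob M" and f: "continuous_on unit_circle f" and g: "continuous_on unit_circle g"
    and le: "\<And>z. z \<in> unit_circle \<Longrightarrow> norm (f z - g z) \<le> e"
  shows "norm ((\<integral>z. f z \<partial>M) - (\<integral>z. g z \<partial>M)) \<le> e"
proof -
  interpret prob_space M using M by (simp add: circle_prob_def)
  have I: "integrable M f" "integrable M g"
    using M f g by (auto intro: integrable_on_circle)
  have "norm ((\<integral>z. f z \<partial>M) - (\<integral>z. g z \<partial>M)) = norm (\<integral>z. f z - g z \<partial>M)"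
    using I by simp
  also have "\<dots> \<le> (\<integral>z. norm (f z - g z) \<partial>M)"
    using I by (intro integral_norm_bound)
  also have "\<dots> \<le> (\<integral>z. e \<partial>M)"
    using I circle_prob_space[OF M] le by (intro integral_mono) auto
  finally show ?thesis by (simp add: prob_space)
qed

lemma continuous_on_powi_circle [continuous_intros]:
  fixes n :: int
  shows "continuous_on unit_circle (\<lambda>z. z powi n)"
  by (intro continuous_intros) auto

lemma cnj_eq_inverse_circle:
  assumes "norm z = 1"
  shows "cnj z = inverse z"
  using assms complex_norm_square[of z] by (intro inverse_unique[symmetric]) simp

lemma powi_add_circle:
  assumes "norm (z :: complex) = 1"
  shows "z powi (m + n) = z powi m * z powi n"
  using assms by (intro power_int_add) auto

lemma measurable_cis_circle:
  assumes "sets M = sets borel"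
  shows "cis \<in> measurable M borel_circle" "(\<lambda>t. cis (c * t)) \<in> measurable M borel_circle"
proof -
  have "(\<lambda>t. cis (c * t)) \<in> measurable borel borel_circle" for c
    by (auto intro!: measurable_restrict_space2 borel_measurable_continuous_onI continuous_intros)
  then have *: "(\<lambda>t. cis (c * t)) \<in> measurable M borel_circle" for c
    using measurable_cong_sets[OF assms refl] by blast
  show "(\<lambda>t. cis (c * t)) \<in> measurable M borel_circle" by (rule *)
  show "cis \<in> measurable M borel_circle" using *[of 1] by simp
qed

lemma circle_prob_lebesgue: "circle_prob circle_lebesgue"
proof -
  interpret U: prob_space "uniform_measure lborel {0..<1::real}"
    by (rule prob_space_uniform_measure) auto
  show ?thesis
    unfolding circle_prob_def circle_lebesgue_def
    by (auto intro!: U.prob_space_distr measurable_cis_circle)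
qed

lemma fourier_coeff_lebesgue:
  "fourier_coeff circle_lebesgue n = (if n = 0 then 1 else 0)"
proof (cases "n = 0")
  case True
  interpret prob_space circle_lebesgue
    using circle_prob_lebesgue by (simp add: circle_prob_def)
  show ?thesis using True prob_space by (simp add: fourier_coeff_def)
next
  case False
  define h where "h t = cis (2 * pi * (of_int n * t))" for t :: real
  define K where "K = \<i> * complex_of_real (2 * pi * of_int n)"
  have ne: "K \<noteq> 0"
    using False by (simp add: K_def)
  have h_exp: "h t = exp (K * of_real t)" for t
    by (simp add: h_def K_def cis_conv_exp mult_ac)
  have h_cont: "continuous_on A h" for A
    unfolding h_def by (intro continuous_intros)
  then have h_meas: "h \<in> borel_measurable borel"
    by (rule borel_measurable_continuous_onI)
  have "fourier_coeff circle_lebesgue n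
      = (\<integral>t. cis (2 * pi * t) powi n \<partial>uniform_measure lborel {0..<1})"
    unfolding fourier_coeff_def circle_lebesgue_def
    by (intro integral_distr measurable_on_circle measurable_cis_circle continuous_on_powi_circle)
       auto
  also have "\<dots> = (\<integral>t. h t \<partial>uniform_measure lborel {0..<1})"
    by (simp add: h_def Complex.DeMoivre2 cis_power_int mult_ac)
  also have "\<dots> = (\<integral>t. indicator {0..<1} t *\<^sub>R h t \<partial>lborel)"
  proof -
    have "uniform_measure lborel {0..<1::real} = density lborel (\<lambda>t. ennreal (indicator {0..<1} t))"
      by (simp add: uniform_measure_def ennreal_indicator divide_ennreal_def)
    then show ?thesis
      using h_meas by (simp add: integral_density)
  qed
  \<comment> \<open>Closing the interval at the null point 1 brings the integral into the form
    required by the fundamental theorem of calculus.\<close>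
  also have "\<dots> = (\<integral>t. indicator {0..1} t *\<^sub>R h t \<partial>lborel)"
  proof (rule integral_cong_AE)
    show "AE t in lborel. indicator {0..<1} t *\<^sub>R h t = indicator {0..1} t *\<^sub>R h t"
      by (rule AE_I'[of "{1}"]) (auto simp: indicator_def)
  qed (use h_meas in measurable)
  also have "\<dots> = h 1 / K - h 0 / K"
  proof (rule integral_FTC_atLeastAtMost)
    fix x :: real
    have "((\<lambda>w. exp (K * w) / K) has_field_derivative exp (K * of_real x)) (at (of_real x))"
      using ne by (auto intro!: derivative_eq_intros)
    from has_vector_derivative_real_field[OF this]
    show "((\<lambda>t. h t / K) has_vector_derivative h x) (at x within {0..1})"
      by (simp add: h_exp)
  qed (auto intro: h_cont)
  also have "h 1 = h 0"
    unfolding h_def by (simp add: cis_multiple_2pi)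
  finally show ?thesis using False by simp
qed

text \<open>A bounded Borel choice of argument. It carries circle measures to the real line, where
  Helly selection for tight sequences applies. Measurability suffices, so the jump of the argument
  at -1 does no harm.\<close>

lemma exists_measurable_lift:
  obtains \<theta> :: "complex \<Rightarrow> real" where "\<theta> \<in> borel_measurable borel_circle"
    "\<And>z. z \<in> unit_circle \<Longrightarrow> cis (\<theta> z) = z" "\<And>z. z \<in> unit_circle \<Longrightarrow> \<bar>\<theta> z\<bar> \<le> pi"
proof
  define \<theta> where "\<theta> z = (if 0 \<le> Im z then arccos (Re z) else - arccos (Re z))" for z
  have bd: "-1 \<le> Re z" "Re z \<le> 1" if "z \<in> unit_circle" for z
    using abs_Re_le_cmod[of z] that by auto
  have "(\<lambda>z. arccos (Re z)) \<in> borel_measurable borel_circle"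
    using bd by (intro measurable_on_circle) (auto intro!: continuous_intros)
  moreover have "Im \<in> borel_measurable borel_circle"
    by (intro measurable_on_circle) (auto intro!: continuous_intros)
  ultimately show "\<theta> \<in> borel_measurable borel_circle"
    unfolding \<theta>_def by measurable
  show "cis (\<theta> z) = z" if z: "z \<in> unit_circle" for z
  proof -
    have "sqrt (1 - (Re z)\<^sup>2) = \<bar>Im z\<bar>"
    proof -
      have "1 - (Re z)\<^sup>2 = (Im z)\<^sup>2"
        using z cmod_power2[of z] by simp
      then show ?thesis by simp
    qed
    then show ?thesis
      using bd[OF z] by (auto simp: \<theta>_def complex_eq_iff sin_arccos cos_arccos)
  qed
  show "\<bar>\<theta> z\<bar> \<le> pi" if "z \<in> unit_circle" for z
    using arccos_bounded bd[OF that] by (auto simp: \<theta>_def)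
qed

section \<open>Weak limits and Fourier coefficients\<close>

text \<open>Sequential compactness of probability measures on the circle: lift to the line, extract
  a weakly convergent subsequence there, and push its limit back by \<open>cis\<close>. A continuous
  \<open>f\<close> on the circle becomes the bounded continuous test function
  \<open>f (cis t)\<close>.\<close>

lemma weak_star_subsequence:
  assumes \<mu>: "\<And>N. circle_prob (\<mu> N)"
  obtains s :: "nat \<Rightarrow> nat" and \<sigma> where "strict_mono s" "circle_prob \<sigma>"
    "weak_star_limit (\<mu> \<circ> s) \<sigma>"
proof -
  obtain \<theta> :: "complex \<Rightarrow> real" where \<theta>: "\<theta> \<in> borel_measurable borel_circle"
    "\<And>z. z \<in> unit_circle \<Longrightarrow> cis (\<theta> z) = z" "\<And>z. z \<in> unit_circle \<Longrightarrow> \<bar>\<theta> z\<bar> \<le> pi"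
    using exists_measurable_lift by blast
  define \<nu> where "\<nu> N = distr (\<mu> N) borel \<theta>" for N
  have sets: "sets (\<mu> N) = sets borel_circle" and prob: "prob_space (\<mu> N)" for N
    using \<mu> by (auto simp: circle_prob_def)
  have \<theta>_meas: "\<theta> \<in> borel_measurable (\<mu> N)" for N
    using \<theta>(1) measurable_cong_sets[OF sets refl] by blast
  have \<nu>: "real_distribution (\<nu> N)" for N
    unfolding \<nu>_def real_distribution_def real_distribution_axioms_def
    using prob_space.prob_space_distr[OF prob \<theta>_meas] by simp
  \<comment> \<open>All lifted values lie in [-pi, pi], and pi < 4, so one bounded interval carries
    the full mass of every lifted measure. This is tightness.\<close>
  have "measure (\<nu> N) {-4<..4} = 1" for N
  proof -
    have "\<theta> -` {-4<..4} \<inter> space (\<mu> N) = space (\<mu> N)"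
      using \<theta>(3) circle_prob_space[OF \<mu>] pi_less_4 by force
    then show ?thesis
      unfolding \<nu>_def using \<theta>_meas by (simp add: measure_distr prob_space.prob_space[OF prob])
  qed
  then have "tight \<nu>"
    unfolding tight_def using \<nu>
    by (intro conjI allI impI exI[of _ "-4"] exI[of _ 4]) auto
  then obtain s M where s: "strict_mono (s :: nat \<Rightarrow> nat)" and M: "real_distribution M"
    and conv: "weak_conv_m (\<nu> \<circ> s) M"
    using tight_imp_convergent_subsubsequence[of \<nu> id] by (auto simp: strict_mono_def)
  interpret M: real_distribution M by (rule M)
  define \<sigma> where "\<sigma> = distr M borel_circle cis"
  have cis: "cis \<in> measurable M borel_circle"
    by (rule measurable_cis_circle) simp
  have "circle_prob \<sigma>"
    unfolding \<sigma>_def circle_prob_def using M.prob_space_distr[OF cis] by simp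
  moreover have "weak_star_limit (\<mu> \<circ> s) \<sigma>"
    unfolding weak_star_limit_def
  proof (intro allI impI)
    fix f :: "complex \<Rightarrow> complex" assume f: "continuous_on unit_circle f"
    obtain B where B: "\<And>z. z \<in> unit_circle \<Longrightarrow> norm (f z) \<le> B"
      using continuous_on_circle_bounded[OF f] by blast
    have cont: "continuous_on UNIV (\<lambda>t. f (cis t))"
      by (rule continuous_on_compose2[OF f]) (auto intro!: continuous_intros)
    have "(\<lambda>N. \<integral>t. f (cis t) \<partial>(\<nu> \<circ> s) N) \<longlonglongrightarrow> (\<integral>t. f (cis t) \<partial>M)"
      using cont B \<nu> M conv
      by (intro weak_conv_imp_integral_bdd_continuous_conv[where B=B])
         (auto simp: continuous_on_eq_continuous_at o_def)
    moreover have "(\<integral>t. f (cis t) \<partial>\<nu> N) = (\<integral>z. f z \<partial>\<mu> N)" for N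
    proof -
      have "(\<integral>t. f (cis t) \<partial>\<nu> N) = (\<integral>z. f (cis (\<theta> z)) \<partial>\<mu> N)"
        unfolding \<nu>_def using \<theta>_meas borel_measurable_continuous_onI[OF cont]
        by (intro integral_distr) auto
      also have "\<dots> = (\<integral>z. f z \<partial>\<mu> N)"
        using \<theta>(2) circle_prob_space[OF \<mu>] by (intro Bochner_Integration.integral_cong) auto
      finally show ?thesis .
    qed
    moreover have "(\<integral>t. f (cis t) \<partial>M) = (\<integral>z. f z \<partial>\<sigma>)"
      unfolding \<sigma>_def using cis measurable_on_circle[OF f]
      by (intro integral_distr[symmetric]) auto
    ultimately show "(\<lambda>N. \<integral>z. f z \<partial>(\<mu> \<circ> s) N) \<longlonglongrightarrow> (\<integral>z. f z \<partial>\<sigma>)"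
      by simp
  qed
  ultimately show ?thesis
    using s that by blast
qed

text \<open>Multiplying by a real polynomial preserves convergence of all the twisted integrals, because
  on the circle \<open>Re z\<close> and \<open>Im z\<close> are combinations of \<open>z\<close> and \<open>z\<^sup>-\<^sup>1\<close>. This avoids writing
  polynomials as finite Fourier sums.\<close>

lemma tendsto_integral_polynomial_times:
  fixes P :: "complex \<Rightarrow> real" and g :: "complex \<Rightarrow> complex"
  assumes \<mu>: "\<And>N. circle_prob (\<mu> N)" and \<sigma>: "circle_prob \<sigma>"
    and P: "real_polynomial_function P"
    and g: "continuous_on unit_circle g"
    and conv: "\<And>n. (\<lambda>N. \<integral>z. g z * z powi n \<partial>\<mu> N) \<longlonglongrightarrow> (\<integral>z. g z * z powi n \<partial>\<sigma>)"
  shows "(\<lambda>N. \<integral>z. of_real (P z) * g z * z powi n \<partial>\<mu> N)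
    \<longlonglongrightarrow> (\<integral>z. of_real (P z) * g z * z powi n \<partial>\<sigma>)"
  using P g conv
proof (induction P arbitrary: g n rule: real_polynomial_function.induct)
  case (linear f)
  \<comment> \<open>These come from linearity, f z = Re z * f 1 + Im z * f i, after inserting Re z =
    (z + cnj z) / 2 and Im z = (z - cnj z) / (2 i).\<close>
  define a b where "a = of_real (f 1) / 2 - \<i> * of_real (f \<i>) / 2"
    and "b = of_real (f 1) / 2 + \<i> * of_real (f \<i>) / (2 :: complex)"
  have f: "of_real (f z) = a * z powi 1 + b * z powi (-1)" if "z \<in> unit_circle" for z
  proof -
    have "f z = f (Re z *\<^sub>R 1 + Im z *\<^sub>R \<i>)"
      by (rule arg_cong[of _ _ f]) (simp add: complex_eq_iff)
    also have "\<dots> = Re z * f 1 + Im z * f \<i>"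
      using linear by (simp add: bounded_linear.linear linear_add linear_scale)
    finally have "f z = Re z * f 1 + Im z * f \<i>" .
    then have "of_real (f z) = a * z + b * cnj z"
      by (simp add: a_def b_def complex_eq_iff field_simps)
    then show ?thesis
      using that by (simp add: power_int_minus cnj_eq_inverse_circle)
  qed
  have eq: "(\<integral>z. of_real (f z) * g z * z powi n \<partial>M)
    = a * (\<integral>z. g z * z powi (n + 1) \<partial>M) + b * (\<integral>z. g z * z powi (n - 1) \<partial>M)"
    if M: "circle_prob M" for M
  proof -
    have I: "integrable M (\<lambda>z. g z * z powi k)" for k
      using M linear.prems(1) by (intro integrable_on_circle) (auto intro!: continuous_intros)
    have "(\<integral>z. of_real (f z) * g z * z powi n \<partial>M)
      = (\<integral>z. a * (g z * z powi (n + 1)) + b * (g z * z powi (n - 1)) \<partial>M)"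
    proof (rule Bochner_Integration.integral_cong[OF refl])
      fix z assume "z \<in> space M"
      then have z: "z \<in> unit_circle" using circle_prob_space[OF M] by simp
      then have "z powi (n + 1) = z powi n * z powi 1" "z powi (n - 1) = z powi n * z powi (-1)"
        using powi_add_circle[of z n 1] powi_add_circle[of z n "-1"] by auto
      then show "of_real (f z) * g z * z powi n
          = a * (g z * z powi (n + 1)) + b * (g z * z powi (n - 1))"
        by (simp only: f[OF z]) (simp add: algebra_simps)
    qed
    also have "\<dots> = a * (\<integral>z. g z * z powi (n + 1) \<partial>M) + b * (\<integral>z. g z * z powi (n - 1) \<partial>M)"
      using I by simp
    finally show ?thesis .
  qed
  show ?case
    unfolding eq[OF \<mu>] eq[OF \<sigma>] by (intro tendsto_intros linear.prems(2))
next
  case (const c)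
  show ?case
    using tendsto_mult_left[OF const(2)[of n], of "of_real c"] by (simp add: mult.assoc)
next
  case (add f h)
  have eq: "(\<integral>z. of_real (f z + h z) * g z * z powi n \<partial>M)
    = (\<integral>z. of_real (f z) * g z * z powi n \<partial>M) + (\<integral>z. of_real (h z) * g z * z powi n \<partial>M)"
    if M: "circle_prob M" for M
  proof -
    have "integrable M (\<lambda>z. of_real (k z) * g z * z powi n)" if "real_polynomial_function k" for k
      using M add.prems(1) continuous_on_polymonial_function[of k] that
      by (intro integrable_on_circle)
         (auto intro!: continuous_intros simp: real_polynomial_function_eq)
    then show ?thesis
      using add.hyps by (subst Bochner_Integration.integral_add[symmetric]) (auto simp: algebra_simps)
  qed
  show ?case
    unfolding eq[OF \<mu>] eq[OF \<sigma>] by (intro tendsto_add add.IH add.prems)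
next
  case (mult f h)
  have "continuous_on unit_circle (\<lambda>z. of_real (h z) * g z)"
    using mult continuous_on_polymonial_function[of h]
    by (auto intro!: continuous_intros simp: real_polynomial_function_eq)
  \<comment> \<open>The hypothesis for \<open>f\<close> is used with the weight \<open>h * g\<close>
    in place of \<open>g\<close>; the hypothesis for \<open>h\<close> supplies the convergence it
    asks for. Hence the induction keeps \<open>g\<close> arbitrary.\<close>
  from mult.IH(1)[OF this] mult.IH(2)[OF mult.prems] show ?case
    by (simp add: mult.assoc)
qed

text \<open>Stone-Weierstrass approximates a test function uniformly by a polynomial in Re z and Im
  z. Convergence passes from the characters to such polynomials, and the uniform error is harmless
  for probability measures.\<close>

lemma weak_star_limit_fourier:
  assumes \<mu>: "\<And>N. circle_prob (\<mu> N)" and \<sigma>: "circle_prob \<sigma>"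
    and conv: "\<And>n. (\<lambda>N. fourier_coeff (\<mu> N) n) \<longlonglongrightarrow> fourier_coeff \<sigma> n"
  shows "weak_star_limit \<mu> \<sigma>"
proof -
  have poly: "(\<lambda>N. \<integral>z. of_real (P z) * c \<partial>\<mu> N) \<longlonglongrightarrow> (\<integral>z. of_real (P z) * c \<partial>\<sigma>)"
    if "real_polynomial_function P" for P and c :: complex
  proof -
    have "(\<lambda>N. \<integral>z. c * z powi n \<partial>\<mu> N) \<longlonglongrightarrow> (\<integral>z. c * z powi n \<partial>\<sigma>)" for n
      using tendsto_mult_left[OF conv[of n], of c] by (simp add: fourier_coeff_def)
    from tendsto_integral_polynomial_times[OF \<mu> \<sigma> that continuous_on_const this, of 0]
    show ?thesis by simp
  qed
  show ?thesis
    unfolding weak_star_limit_def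
  proof (intro allI impI LIMSEQ_I)
    fix f :: "complex \<Rightarrow> complex" and e :: real
    assume f: "continuous_on unit_circle f" and e: "0 < e"
    obtain g where g: "polynomial_function g" "\<And>z. z \<in> unit_circle \<Longrightarrow> norm (f z - g z) < e / 3"
      using Stone_Weierstrass_polynomial_function[OF compact_sphere f, of "e / 3"] e by auto
    have g_cont: "continuous_on unit_circle g"
      using g(1) by (rule continuous_on_polymonial_function)
    have Re: "real_polynomial_function (\<lambda>z. Re (g z))" and Im: "real_polynomial_function (\<lambda>z. Im (g z))"
      using g(1) bounded_linear_Re bounded_linear_Im by (auto simp: polynomial_function_def o_def)
    have split: "(\<integral>z. g z \<partial>M)
        = (\<integral>z. of_real (Re (g z)) * 1 \<partial>M) + (\<integral>z. of_real (Im (g z)) * \<i> \<partial>M)"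
      if M: "circle_prob M" for M
    proof -
      have "(\<integral>z. g z \<partial>M) = (\<integral>z. of_real (Re (g z)) * 1 + of_real (Im (g z)) * \<i> \<partial>M)"
        by (rule Bochner_Integration.integral_cong[OF refl]) (simp add: complex_eq_iff)
      also have "\<dots> = (\<integral>z. of_real (Re (g z)) * 1 \<partial>M) + (\<integral>z. of_real (Im (g z)) * \<i> \<partial>M)"
        using g_cont
        by (intro Bochner_Integration.integral_add integrable_on_circle[OF M])
           (auto intro!: continuous_intros)
      finally show ?thesis .
    qed
    have "(\<lambda>N. \<integral>z. g z \<partial>\<mu> N) \<longlonglongrightarrow> (\<integral>z. g z \<partial>\<sigma>)"
      unfolding split[OF \<mu>] split[OF \<sigma>] by (intro tendsto_add poly Re Im)
    then obtain N0 where N0: "norm ((\<integral>z. g z \<partial>\<mu> N) - (\<integral>z. g z \<partial>\<sigma>)) < e / 3" if "N \<ge> N0" for N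
      using LIMSEQ_D[of _ _ "e / 3"] e by (metis divide_pos_pos zero_less_numeral)
    have close: "norm ((\<integral>z. f z \<partial>M) - (\<integral>z. g z \<partial>M)) \<le> e / 3" if "circle_prob M" for M
      using g(2) by (intro norm_integral_diff_le_on_circle[OF that f g_cont] less_imp_le)
    show "\<exists>N0. \<forall>N\<ge>N0. norm ((\<integral>z. f z \<partial>\<mu> N) - (\<integral>z. f z \<partial>\<sigma>)) < e"
    proof (intro exI allI impI)
      fix N assume "N0 \<le> N"
      have "norm ((\<integral>z. f z \<partial>\<mu> N) - (\<integral>z. f z \<partial>\<sigma>))
        \<le> norm ((\<integral>z. f z \<partial>\<mu> N) - (\<integral>z. g z \<partial>\<mu> N)) + norm ((\<integral>z. g z \<partial>\<mu> N) - (\<integral>z. g z \<partial>\<sigma>))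
          + norm ((\<integral>z. g z \<partial>\<sigma>) - (\<integral>z. f z \<partial>\<sigma>))"
        by norm
      also have "\<dots> < e"
        using close[OF \<mu>, of N] N0[OF \<open>N0 \<le> N\<close>] close[OF \<sigma>]
        by (simp add: norm_minus_commute[of "\<integral>z. g z \<partial>\<sigma>"])
      finally show "norm ((\<integral>z. f z \<partial>\<mu> N) - (\<integral>z. f z \<partial>\<sigma>)) < e" .
    qed
  qed
qed

text \<open>Compactness gives a limit along a subsequence only. Since each Fourier coefficient
  converges along the whole sequence, its limit must be the coefficient of that measure, which
  upgrades the convergence to the whole sequence.\<close>

lemma weak_star_limit_exists:
  assumes \<mu>: "\<And>N. circle_prob (\<mu> N)" and conv: "\<And>n. convergent (\<lambda>N. fourier_coeff (\<mu> N) n)"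
  obtains \<sigma> where "circle_prob \<sigma>" "weak_star_limit \<mu> \<sigma>"
    "\<And>n. (\<lambda>N. fourier_coeff (\<mu> N) n) \<longlonglongrightarrow> fourier_coeff \<sigma> n"
proof -
  obtain s :: "nat \<Rightarrow> nat" and \<sigma> where s: "strict_mono s" and \<sigma>: "circle_prob \<sigma>"
    and w: "weak_star_limit (\<mu> \<circ> s) \<sigma>"
    using weak_star_subsequence[of \<mu>] \<mu> by blast
  have lim: "(\<lambda>N. fourier_coeff (\<mu> N) n) \<longlonglongrightarrow> fourier_coeff \<sigma> n" for n
  proof -
    obtain L where L: "(\<lambda>N. fourier_coeff (\<mu> N) n) \<longlonglongrightarrow> L"
      using conv by (auto simp: convergent_def)
    have "(\<lambda>N. fourier_coeff (\<mu> (s N)) n) \<longlonglongrightarrow> fourier_coeff \<sigma> n"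
      using w continuous_on_powi_circle[of n]
      unfolding weak_star_limit_def fourier_coeff_def by simp
    moreover have "(\<lambda>N. fourier_coeff (\<mu> (s N)) n) \<longlonglongrightarrow> L"
      using LIMSEQ_subseq_LIMSEQ[OF L s] by (simp add: o_def)
    ultimately show ?thesis
      using L LIMSEQ_unique by blast
  qed
  show ?thesis
    using that[OF \<sigma> weak_star_limit_fourier[OF \<mu> \<sigma> lim] lim] .
qed

text \<open>Orthogonality of the characters \<open>z\<^bsup>u i\<^esup>\<close> in \<open>L\<^sup>2(\<sigma>)\<close> makes their average concentrate at
  most \<open>1/m\<close> of the mass at any point.\<close>

lemma continuous_measure_if_orthogonal_characters:
  fixes u :: "nat \<Rightarrow> int"
  assumes \<sigma>: "circle_prob \<sigma>"
    and orth: "\<And>i j. j < i \<Longrightarrow> fourier_coeff \<sigma> (u i - u j) = 0 \<and> fourier_coeff \<sigma> (u j - u i) = 0"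
  shows "continuous_measure \<sigma>"
  unfolding continuous_measure_def
proof
  fix w :: complex assume w: "w \<in> unit_circle"
  interpret prob_space \<sigma> using \<sigma> by (simp add: circle_prob_def)
  have sets: "{w} \<in> sets \<sigma>"
    using \<sigma> w by (auto simp: circle_prob_def sets_restrict_space image_iff intro!: bexI[of _ "{w}"])
  have wn: "norm w = 1" using w by simp
  have bound: "m * measure \<sigma> {w} \<le> 1" for m :: nat
  proof (cases "m = 0")
    case False
    \<comment> \<open>Each summand is rotated to equal 1 at \<open>w\<close>, so g(w) = m, while
      orthogonality gives a squared norm of only m. Comparing the two yields m^2 times the mass of
      \<open>w\<close> at most m.\<close>
    define g where "g z = (\<Sum>i<m. z powi u i * w powi (- u i))" for z
    have g_cont: "continuous_on unit_circle g"
      unfolding g_def by (intro continuous_intros)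
    have gw: "g w = of_nat m"
    proof -
      have "w powi u i * w powi (- u i) = 1" for i
        using powi_add_circle[OF wn, of "u i" "- u i"] by simp
      then show ?thesis by (simp add: g_def)
    qed
    have I: "integrable \<sigma> (\<lambda>z. (norm (g z))\<^sup>2)"
      using g_cont by (intro integrable_on_circle[OF \<sigma>]) (auto intro!: continuous_intros)
    have "of_real (\<integral>z. (norm (g z))\<^sup>2 \<partial>\<sigma>) = (\<integral>z. of_real ((norm (g z))\<^sup>2) \<partial>\<sigma> :: complex)"
      by (rule integral_complex_of_real[symmetric])
    also have "\<dots> = (\<integral>z. (\<Sum>i<m. \<Sum>j<m. w powi (u j - u i) * z powi (u i - u j)) \<partial>\<sigma>)"
    proof (rule Bochner_Integration.integral_cong[OF refl])
      fix z assume "z \<in> space \<sigma>"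
      then have z: "norm z = 1" using circle_prob_space[OF \<sigma>] by simp
      have cnj: "cnj (x powi k) = x powi (-k)" if "norm x = 1" for x :: complex and k
        using that by (simp add: power_int_minus power_int_inverse cnj_eq_inverse_circle)
      have "of_real ((norm (g z))\<^sup>2) = g z * cnj (g z)"
        by (rule complex_norm_square)
      also have "\<dots> = (\<Sum>i<m. \<Sum>j<m. (z powi u i * w powi (- u i)) * (z powi (- u j) * w powi u j))"
        unfolding g_def cnj_sum sum_product complex_cnj_mult cnj[OF z] cnj[OF wn] by simp
      also have "\<dots> = (\<Sum>i<m. \<Sum>j<m. w powi (u j - u i) * z powi (u i - u j))"
        using powi_add_circle[OF wn, of "u _" "- u _"] powi_add_circle[OF z, of "u _" "- u _"]
        by (simp add: mult_ac)
      finally show "of_real ((norm (g z))\<^sup>2)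
        = (\<Sum>i<m. \<Sum>j<m. w powi (u j - u i) * z powi (u i - u j))" .
    qed
    also have "\<dots> = (\<Sum>i<m. \<Sum>j<m. w powi (u j - u i) * fourier_coeff \<sigma> (u i - u j))"
      unfolding fourier_coeff_def
      by (subst Bochner_Integration.integral_sum, (auto intro!: integrable_on_circle[OF \<sigma>] continuous_intros)[1],
          rule sum.cong[OF refl], subst Bochner_Integration.integral_sum)
         (auto intro!: integrable_on_circle[OF \<sigma>] continuous_intros)
    also have "\<dots> = (\<Sum>i<m. \<Sum>j<m. if i = j then 1 else 0)"
    proof (intro sum.cong refl)
      fix i j
      show "w powi (u j - u i) * fourier_coeff \<sigma> (u i - u j) = (if i = j then 1 else 0)"
        using orth[of i j] orth[of j i] prob_space
        by (cases i j rule: linorder_cases) (auto simp: fourier_coeff_def)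
    qed
    also have "\<dots> = of_real (real m)"
      by simp
    finally have int: "(\<integral>z. (norm (g z))\<^sup>2 \<partial>\<sigma>) = m"
      unfolding of_real_eq_iff .
    have "(\<integral>z. real m ^ 2 * indicator {w} z \<partial>\<sigma>) \<le> (\<integral>z. (norm (g z))\<^sup>2 \<partial>\<sigma>)"
    proof (rule integral_mono[OF _ I])
      show "integrable \<sigma> (\<lambda>z. real m ^ 2 * indicator {w} z)"
        using sets by (intro integrable_mult_right integrable_real_indicator) (auto simp: less_top[symmetric])
    qed (auto simp: gw indicator_def)
    then have "real m * (m * measure \<sigma> {w}) \<le> real m * 1"
      unfolding int using sets by (simp add: power2_eq_square mult.assoc)
    then show ?thesis
      using False by (subst (asm) mult_le_cancel_left_pos) auto
  qed simp
  have "measure \<sigma> {w} = 0"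
  proof (rule ccontr)
    assume "measure \<sigma> {w} \<noteq> 0"
    then have "measure \<sigma> {w} > 0"
      using measure_nonneg[of \<sigma> "{w}"] by linarith
    then obtain m :: nat where "1 < m * measure \<sigma> {w}"
      using ex_less_of_nat_mult by blast
    then show False
      using bound[of m] by simp
  qed
  then show "emeasure \<sigma> {w} = 0"
    by (simp add: emeasure_eq_measure)
qed

section \<open>Tent kernels\<close>

text \<open>The tent descends to 0 with slope 1. A sharp cutoff would give an autocorrelation defect
  linear in s / M, whereas the hypothesis of the theorem controls only squares of such
  ratios.\<close>

definition tent :: "nat \<Rightarrow> int \<Rightarrow> real" where
  "tent M j = max 0 (real_of_int (int M - \<bar>j\<bar>))"

definition tent_energy :: "nat \<Rightarrow> real" where
  "tent_energy M = (\<Sum>j=-int M..int M. (tent M j)\<^sup>2)"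

text \<open>The normalized autocorrelation of the tent, which supplies the Fourier coefficients of
  \<open>tent_kernel\<close>; dividing by the energy makes the constant one equal to 1 when M >
  0.\<close>

definition tent_corr :: "nat \<Rightarrow> int \<Rightarrow> real" where
  "tent_corr M t = (\<Sum>j=-int M..int M. tent M j * tent M (j + t)) / tent_energy M"

definition tent_kernel :: "nat \<Rightarrow> complex \<Rightarrow> real" where
  "tent_kernel M z =
     (norm (\<Sum>j=-int M..int M. of_real (tent M j) * z powi j))\<^sup>2 / tent_energy M"

lemma tent_nonneg: "0 \<le> tent M j"
  by (simp add: tent_def)

lemma tent_eq_0: "j \<notin> {-int M..int M} \<Longrightarrow> tent M j = 0"
  by (auto simp: tent_def)

lemma sum_shift_support:
  fixes f :: "int \<Rightarrow> 'a::comm_monoid_add"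
  assumes "finite T" "\<And>i. i \<notin> W \<Longrightarrow> f i = 0" "\<And>i. i \<in> W \<Longrightarrow> i - j \<in> T"
  shows "(\<Sum>t\<in>T. f (j + t)) = (\<Sum>i\<in>W. f i)"
proof -
  have "(\<Sum>t\<in>T. f (j + t)) = (\<Sum>i\<in>(+) j ` T. f i)"
    by (simp add: sum.reindex o_def)
  also have "\<dots> = (\<Sum>i\<in>W. f i)"
    using assms by (intro sum.mono_neutral_right) (force simp: image_iff)+
  finally show ?thesis .
qed

lemma sum_squares_lower_bound: "real M ^ 3 / 3 \<le> (\<Sum>i\<le>M. (real i)\<^sup>2)"
  by (induction M) (auto simp: power3_eq_cube power2_eq_square algebra_simps)

text \<open>The nonnegative half of the tent already contributes 0^2 + 1^2 + ... + M^2.\<close>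

lemma tent_energy_lower_bound: "real M ^ 3 / 3 \<le> tent_energy M"
proof -
  have "(\<Sum>i\<le>M. (real i)\<^sup>2) = (\<Sum>i\<le>M. (tent M (int M - int i))\<^sup>2)"
    by (intro sum.cong) (auto simp: tent_def)
  also have "\<dots> = (\<Sum>j\<in>(\<lambda>i. int M - int i) ` {..M}. (tent M j)\<^sup>2)"
    by (subst sum.reindex) (auto simp: inj_on_def)
  also have "\<dots> \<le> tent_energy M"
    unfolding tent_energy_def by (intro sum_mono2) auto
  finally show ?thesis
    using sum_squares_lower_bound[of M] by linarith
qed

lemma tent_energy_pos: "0 < M \<Longrightarrow> 0 < tent_energy M"
  using tent_energy_lower_bound[of M] by (smt (verit) divide_pos_pos of_nat_0_less_iff zero_less_power)

lemma tent_kernel_nonneg: "0 \<le> tent_kernel M z"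
  by (auto simp: tent_kernel_def tent_energy_def intro!: divide_nonneg_nonneg sum_nonneg)

lemma tent_corr_0: "0 < M \<Longrightarrow> tent_corr M 0 = 1"
  using tent_energy_pos[of M] by (simp add: tent_corr_def tent_energy_def power2_eq_square)

lemma tent_corr_nonneg: "0 \<le> tent_corr M t"
  by (auto simp: tent_corr_def tent_energy_def tent_nonneg intro!: divide_nonneg_nonneg sum_nonneg)

lemma tent_corr_vanish:
  assumes "2 * int M < \<bar>t\<bar>"
  shows "tent_corr M t = 0"
proof -
  have "tent M (j + t) = 0" if "j \<in> {-int M..int M}" for j
    using that assms by (intro tent_eq_0) auto
  then show ?thesis by (simp add: tent_corr_def)
qed

text \<open>Write the squared modulus as a product with the conjugate and collect the pairs (i, j)
  with i - j = t; such differences have modulus at most 2 M.\<close>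

lemma tent_kernel_expand:
  assumes z: "norm z = 1"
  shows "of_real (tent_kernel M z)
    = (\<Sum>t=-int (2 * M)..int (2 * M). of_real (tent_corr M t) * z powi t)"
proof -
  let ?W = "{-int M..int M}" and ?T = "{-int (2 * M)..int (2 * M)}"
  have z0: "z \<noteq> 0" using z by auto
  have cnj: "cnj (z powi j) = z powi (-j)" for j
    using z by (simp add: power_int_minus power_int_inverse cnj_eq_inverse_circle)
  have "of_real ((norm (\<Sum>j\<in>?W. of_real (tent M j) * z powi j))\<^sup>2)
    = (\<Sum>i\<in>?W. of_real (tent M i) * z powi i) * (\<Sum>j\<in>?W. of_real (tent M j) * z powi (-j))"
    by (simp only: complex_norm_square cnj_sum complex_cnj_mult complex_cnj_complex_of_real cnj)
  also have "\<dots> = (\<Sum>j\<in>?W. \<Sum>i\<in>?W. of_real (tent M j * tent M i) * z powi (i - j))"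
    unfolding sum_product
    by (subst sum.swap) (simp add: power_int_diff power_int_minus z0 field_simps)
  also have "\<dots> = (\<Sum>j\<in>?W. \<Sum>t\<in>?T. of_real (tent M j * tent M (j + t)) * z powi t)"
  proof (rule sum.cong[OF refl])
    fix j assume j: "j \<in> ?W"
    have "(\<Sum>t\<in>?T. of_real (tent M j * tent M (j + t)) * z powi (j + t - j))
        = (\<Sum>i\<in>?W. of_real (tent M j * tent M i) * z powi (i - j))"
      using j by (intro sum_shift_support) (auto simp: tent_eq_0)
    then show "(\<Sum>i\<in>?W. of_real (tent M j * tent M i) * z powi (i - j))
        = (\<Sum>t\<in>?T. of_real (tent M j * tent M (j + t)) * z powi t)"
      by simp
  qed
  also have "\<dots> = (\<Sum>t\<in>?T. of_real (\<Sum>j\<in>?W. tent M j * tent M (j + t)) * z powi t)"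
    by (subst sum.swap) (simp add: sum_distrib_right)
  finally show ?thesis
    unfolding tent_kernel_def tent_corr_def of_real_divide
    by (simp only: sum_divide_distrib[of _ "?T"] times_divide_eq_left)
qed

text \<open>Both bounds come from \<open>2 E (1 - c(s)) = \<Sum>\<^sub>j (u\<^sub>j - u\<^bsub>j+s\<^esub>)\<^sup>2\<close>, where \<open>u\<close> is the tent and
  \<open>E\<close> its energy: at most \<open>6 M\<close> terms are nonzero, each is at most \<open>s\<^sup>2\<close>, and \<open>E \<ge> M\<^sup>3 / 3\<close>.\<close>

lemma tent_corr_bounds:
  assumes M: "0 < M"
  shows "tent_corr M s \<le> 1" and "1 - tent_corr M s \<le> 9 * (of_int s / real M)\<^sup>2"
proof -
  \<comment> \<open>The window \<open>?T\<close> is widened by |s| so that it contains the supports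
    of both the tent and its translate. The terms \<open>0 + j\<close> below give the unshifted sums
    the shape expected by \<open>sum_shift_support\<close>.\<close>
  let ?W = "{-int M..int M}" and ?T = "{-(int M + \<bar>s\<bar>)..int M + \<bar>s\<bar>}"
  let ?u = "tent M" and ?w = "\<lambda>j. if j \<in> {-int M..int M} then 1 else (0::real)"
  let ?E = "tent_energy M"
  have E: "0 < ?E" using tent_energy_pos[OF M] .
  have "(\<Sum>j\<in>?T. (?u (0 + j))\<^sup>2) = ?E" "(\<Sum>j\<in>?T. (?u (s + j))\<^sup>2) = ?E"
    unfolding tent_energy_def by (rule sum_shift_support; auto simp: tent_eq_0)+
  moreover have "(\<Sum>j\<in>?T. ?u (0 + j) * ?u (0 + j + s)) = ?E * tent_corr M s"
  proof -
    have "(\<Sum>j\<in>?T. ?u (0 + j) * ?u (0 + j + s)) = (\<Sum>j\<in>?W. ?u j * ?u (j + s))"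
      by (rule sum_shift_support) (auto simp: tent_eq_0)
    then show ?thesis using E by (simp add: tent_corr_def)
  qed
  moreover have "(?u j - ?u (s + j))\<^sup>2
      = (?u (0 + j))\<^sup>2 + (?u (s + j))\<^sup>2 - 2 * (?u (0 + j) * ?u (0 + j + s))" for j
    by (simp add: power2_eq_square algebra_simps)
  ultimately have eq: "(\<Sum>j\<in>?T. (?u j - ?u (s + j))\<^sup>2) = 2 * ?E * (1 - tent_corr M s)"
    by (simp only: sum.distrib sum_subtractf flip: sum_distrib_left) (simp add: algebra_simps)
  have "0 \<le> 2 * ?E * (1 - tent_corr M s)"
    unfolding eq[symmetric] by (intro sum_nonneg) auto
  then show "tent_corr M s \<le> 1"
    using E by (simp add: zero_le_mult_iff)
  have w: "(\<Sum>j\<in>?T. ?w (k + j)) \<le> 3 * real M" if "\<bar>k\<bar> \<le> \<bar>s\<bar>" for k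
  proof -
    have "(\<Sum>j\<in>?T. ?w (k + j)) = (\<Sum>j\<in>?W. ?w j)"
      using that by (intro sum_shift_support) auto
    also have "\<dots> = 2 * real M + 1" by simp
    finally show ?thesis using M by simp
  qed
  \<comment> \<open>The two indicators mark the supports of the tent and of its translate, each of 2
    M + 1 <= 3 M points. Off both supports the difference vanishes; on them the Lipschitz bound |s|
    applies.\<close>
  have le_term: "(?u j - ?u (s + j))\<^sup>2 \<le> (of_int s)\<^sup>2 * (?w (0 + j) + ?w (s + j))" for j
  proof (cases "j \<in> ?W \<or> s + j \<in> ?W")
    case True
    have "\<bar>?u j - ?u (s + j)\<bar> \<le> \<bar>of_int s\<bar>"
      unfolding tent_def by linarith
    then have "(?u j - ?u (s + j))\<^sup>2 \<le> (of_int s)\<^sup>2 * 1"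
      by (simp add: abs_le_square_iff)
    also have "\<dots> \<le> (of_int s)\<^sup>2 * (?w (0 + j) + ?w (s + j))"
      using True by (intro mult_left_mono) auto
    finally show ?thesis .
  qed (simp add: tent_eq_0)
  have "2 * ?E * (1 - tent_corr M s) \<le> (of_int s)\<^sup>2 * ((\<Sum>j\<in>?T. ?w (0 + j)) + (\<Sum>j\<in>?T. ?w (s + j)))"
    unfolding eq[symmetric] sum.distrib[symmetric] sum_distrib_left by (intro sum_mono le_term)
  also have "\<dots> \<le> (of_int s)\<^sup>2 * (3 * real M + 3 * real M)"
    by (intro mult_left_mono add_mono w) auto
  finally have "?E * (1 - tent_corr M s) \<le> 3 * (of_int s)\<^sup>2 * real M"
    by (simp add: algebra_simps)
  moreover have "real M ^ 3 / 3 * (1 - tent_corr M s) \<le> ?E * (1 - tent_corr M s)"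
    using \<open>tent_corr M s \<le> 1\<close> tent_energy_lower_bound[of M] by (intro mult_right_mono) auto
  ultimately have "real M ^ 3 / 3 * (1 - tent_corr M s) \<le> 3 * (of_int s)\<^sup>2 * real M"
    by linarith
  then have "real M * ((real M)\<^sup>2 * (1 - tent_corr M s)) \<le> real M * (9 * (of_int s)\<^sup>2)"
    by (simp add: power3_eq_cube power2_eq_square mult_ac)
  then have "(real M)\<^sup>2 * (1 - tent_corr M s) \<le> 9 * (of_int s)\<^sup>2"
    using M by (subst (asm) mult_le_cancel_left_pos) auto
  then show "1 - tent_corr M s \<le> 9 * (of_int s / real M)\<^sup>2"
    using M by (simp add: power_divide field_simps)
qed

section \<open>Riesz products\<close>

text \<open>The data of a generalized Riesz product with its coefficients made explicit. Setting
  \<open>c k t\<close> to 0 beyond the degree lets the product formula for coefficients hold for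
  every digit without side conditions.\<close>

locale riesz_product =
  fixes P :: "nat \<Rightarrow> complex \<Rightarrow> real" and d a :: "nat \<Rightarrow> nat" and c :: "nat \<Rightarrow> int \<Rightarrow> complex"
  assumes expand: "\<And>k z. 1 \<le> k \<Longrightarrow> z \<in> unit_circle \<Longrightarrow>
      complex_of_real (P k z) = (\<Sum>t=-int (d k)..int (d k). c k t * z powi t)"
    and nonneg: "\<And>k z. 1 \<le> k \<Longrightarrow> z \<in> unit_circle \<Longrightarrow> 0 \<le> P k z"
    and coeff_0: "\<And>k. 1 \<le> k \<Longrightarrow> c k 0 = 1"
    and coeff_vanish: "\<And>k t. 1 \<le> k \<Longrightarrow> int (d k) < \<bar>t\<bar> \<Longrightarrow> c k t = 0"
    and a_mono: "strict_mono_on {1..} a"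
    and a_pos: "\<And>k. 1 \<le> k \<Longrightarrow> 0 < a k"
    and dissociated: "\<And>k. 1 \<le> k \<Longrightarrow>
      int (a (k + 1)) - 2 * (\<Sum>j=1..k. int (d j) * int (a j)) \<ge> 1"
begin

definition partial :: "nat \<Rightarrow> complex measure" where
  "partial N = density circle_lebesgue (\<lambda>z. ennreal (\<Prod>k=1..N. P k (z ^ a k)))"

definition degree_bound :: "nat \<Rightarrow> int" where
  "degree_bound N = (\<Sum>j=1..N. int (d j) * int (a j))"

lemma degree_bound_Suc: "degree_bound (Suc N) = degree_bound N + int (d (Suc N)) * int (a (Suc N))"
  by (simp add: degree_bound_def)

text \<open>Includes the empty product N = 0, where the claim is the positivity of the first
  frequency.\<close>

lemma dissociated': "2 * degree_bound N < int (a (Suc N))"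
  using dissociated[of N] a_pos[of 1] by (cases "N = 0") (auto simp: degree_bound_def)

lemma a_le: "N \<le> N' \<Longrightarrow> a (Suc N) \<le> a (Suc N')"
  using a_mono by (cases "N = N'") (auto simp: strict_mono_on_def intro!: less_imp_le)

lemma a_ge: "N < a (Suc N)"
proof (induction N)
  case (Suc N)
  have "a (Suc N) < a (Suc (Suc N))"
    using a_mono by (auto simp: strict_mono_on_def)
  then show ?case using Suc by simp
qed (use a_pos in auto)

lemma P_continuous:
  assumes k: "1 \<le> k" shows "continuous_on unit_circle (P k)"
proof -
  have "continuous_on unit_circle (\<lambda>z. Re (\<Sum>t=-int (d k)..int (d k). c k t * z powi t))"
    by (intro continuous_intros)
  also have "?this \<longleftrightarrow> ?thesis"
    using expand[OF k, symmetric] by (intro continuous_on_cong) auto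
  finally show ?thesis .
qed

lemma prod_continuous: "continuous_on unit_circle (\<lambda>z. \<Prod>k=1..N. P k (z ^ a k))"
proof (intro continuous_on_prod)
  fix k assume "k \<in> {1..N}"
  then show "continuous_on unit_circle (\<lambda>z. P k (z ^ a k))"
    by (intro continuous_on_compose2[OF P_continuous]) (auto intro!: continuous_intros simp: norm_power)
qed

lemma prod_nonneg_circle: "z \<in> unit_circle \<Longrightarrow> 0 \<le> (\<Prod>k=1..N. P k (z ^ a k))"
  by (intro prod_nonneg nonneg) (auto simp: norm_power)

lemma sets_lebesgue: "sets circle_lebesgue = sets borel_circle"
  using circle_prob_lebesgue by (simp add: circle_prob_def)

lemma fourier_coeff_partial:
  "fourier_coeff (partial N) n = (\<integral>z. of_real (\<Prod>k=1..N. P k (z ^ a k)) * z powi n \<partial>circle_lebesgue)"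
proof -
  have "fourier_coeff (partial N) n = (\<integral>z. (\<Prod>k=1..N. P k (z ^ a k)) *\<^sub>R z powi n \<partial>circle_lebesgue)"
    unfolding partial_def fourier_coeff_def
    by (intro integral_density measurable_on_circle prod_continuous continuous_on_powi_circle
          sets_lebesgue AE_I2 prod_nonneg_circle)
       (simp add: circle_prob_space[OF circle_prob_lebesgue])
  then show ?thesis by (simp add: scaleR_conv_of_real)
qed

lemma fourier_coeff_partial_0: "fourier_coeff (partial 0) n = (if n = 0 then 1 else 0)"
  by (simp add: fourier_coeff_partial fourier_coeff_lebesgue flip: fourier_coeff_def)

text \<open>Expanding the last factor turns the product into a convolution along multiples of its
  frequency. The shift has a plus sign because coefficients integrate z^n rather than its
  conjugate.\<close>

lemma fourier_coeff_partial_Suc: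
  "fourier_coeff (partial (Suc N)) n = (\<Sum>t=-int (d (Suc N))..int (d (Suc N)).
     c (Suc N) t * fourier_coeff (partial N) (n + t * int (a (Suc N))))"
proof -
  let ?T = "{-int (d (Suc N))..int (d (Suc N))}" and ?Q = "\<lambda>z. \<Prod>k=1..N. P k (z ^ a k)"
  have "fourier_coeff (partial (Suc N)) n
    = (\<integral>z. (\<Sum>t\<in>?T. c (Suc N) t * (of_real (?Q z) * z powi (n + t * int (a (Suc N))))) \<partial>circle_lebesgue)"
    unfolding fourier_coeff_partial
  proof (rule Bochner_Integration.integral_cong[OF refl])
    fix z assume "z \<in> space circle_lebesgue"
    then have z: "norm z = 1"
      by (simp add: circle_prob_space[OF circle_prob_lebesgue])
    have "of_real (P (Suc N) (z ^ a (Suc N)))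
        = (\<Sum>t\<in>?T. c (Suc N) t * z powi (t * int (a (Suc N))))"
      using z expand[of "Suc N" "z ^ a (Suc N)"]
      by (simp add: norm_power power_int_power mult.commute)
    then show "of_real (\<Prod>k=1..Suc N. P k (z ^ a k)) * z powi n
        = (\<Sum>t\<in>?T. c (Suc N) t * (of_real (?Q z) * z powi (n + t * int (a (Suc N)))))"
      by (simp add: powi_add_circle[OF z] sum_distrib_left sum_distrib_right mult_ac)
  qed
  also have "\<dots> = (\<Sum>t\<in>?T. c (Suc N) t * fourier_coeff (partial N) (n + t * int (a (Suc N))))"
    unfolding fourier_coeff_partial
    by (subst Bochner_Integration.integral_sum)
       (auto intro!: integrable_on_circle[OF circle_prob_lebesgue] continuous_on_mult
          continuous_on_of_real prod_continuous continuous_on_powi_circle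
          simp del: of_real_prod One_nat_def)
  finally show ?thesis .
qed

lemma fourier_coeff_partial_vanish:
  "degree_bound N < \<bar>n\<bar> \<Longrightarrow> fourier_coeff (partial N) n = 0"
proof (induction N arbitrary: n)
  case 0
  then show ?case by (simp add: fourier_coeff_partial_0 degree_bound_def)
next
  case (Suc N)
  have "fourier_coeff (partial N) (n + t * int (a (Suc N))) = 0"
    if t: "t \<in> {-int (d (Suc N))..int (d (Suc N))}" for t
  proof (rule Suc.IH)
    have "\<bar>t * int (a (Suc N))\<bar> \<le> int (d (Suc N)) * int (a (Suc N))"
      using t by (auto simp: abs_mult intro!: mult_right_mono)
    then show "degree_bound N < \<bar>n + t * int (a (Suc N))\<bar>"
      using Suc.prems unfolding degree_bound_Suc by linarith
  qed
  then show ?case by (simp add: fourier_coeff_partial_Suc)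
qed

text \<open>Dissociation: only the term \<open>t = -s\<close> of the convolution has its argument within the spectrum
  of the previous partial product.\<close>

lemma fourier_coeff_partial_Suc_eq:
  assumes m: "2 * \<bar>m\<bar> \<le> int (a (Suc N))"
  shows "fourier_coeff (partial (Suc N)) (m + s * int (a (Suc N)))
    = c (Suc N) (- s) * fourier_coeff (partial N) m"
proof -
  let ?T = "{-int (d (Suc N))..int (d (Suc N))}" and ?a = "int (a (Suc N))"
  have zero: "fourier_coeff (partial N) (m + s * ?a + t * ?a) = 0" if "t \<noteq> - s" for t
  proof (rule fourier_coeff_partial_vanish)
    have "1 * ?a \<le> \<bar>s + t\<bar> * ?a"
      using that by (intro mult_right_mono) auto
    then have "?a \<le> \<bar>s * ?a + t * ?a\<bar>"
      by (simp add: abs_mult flip: distrib_right)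
    then show "degree_bound N < \<bar>m + s * ?a + t * ?a\<bar>"
      using m dissociated'[of N] by linarith
  qed
  have "fourier_coeff (partial (Suc N)) (m + s * ?a)
    = (\<Sum>t\<in>?T. if t = - s then c (Suc N) t * fourier_coeff (partial N) m else 0)"
    unfolding fourier_coeff_partial_Suc using zero by (intro sum.cong) auto
  \<comment> \<open>If - s exceeds the degree, no term of the sum survives, and
    \<open>coeff_vanish\<close> makes the right side 0 as well.\<close>
  also have "\<dots> = c (Suc N) (- s) * fourier_coeff (partial N) m"
    using coeff_vanish[of "Suc N" "- s"] by (auto simp: sum.delta')
  finally show ?thesis .
qed

text \<open>The digit s = 0 of the previous lemma: each later factor multiplies the coefficient by
  its constant coefficient, which is 1.\<close>

lemma fourier_coeff_partial_stable:
  assumes "N \<le> N'" "2 * \<bar>m\<bar> \<le> int (a (Suc N))"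
  shows "fourier_coeff (partial N') m = fourier_coeff (partial N) m"
  using assms(1)
proof (induction rule: dec_induct)
  case (step k)
  then have "2 * \<bar>m\<bar> \<le> int (a (Suc k))"
    using assms(2) a_le[of N k] by linarith
  then show ?case
    using fourier_coeff_partial_Suc_eq[of m k 0] coeff_0[of "Suc k"] step.IH by simp
qed simp

text \<open>The total mass is the coefficient at 0, and stability traces it back to Lebesgue measure
  at N = 0.\<close>

lemma circle_prob_partial: "circle_prob (partial N)"
proof -
  have "fourier_coeff (partial N) 0 = fourier_coeff (partial 0) 0"
    by (rule fourier_coeff_partial_stable) auto
  then have "fourier_coeff (partial N) 0 = 1"
    by (simp only: fourier_coeff_partial_0 simp_thms if_True)
  then have "complex_of_real (\<integral>z. (\<Prod>k=1..N. P k (z ^ a k)) \<partial>circle_lebesgue) = 1"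
    unfolding fourier_coeff_partial by (simp del: of_real_prod)
  then have int: "(\<integral>z. (\<Prod>k=1..N. P k (z ^ a k)) \<partial>circle_lebesgue) = 1"
    unfolding of_real_eq_1_iff .
  have sp: "space circle_lebesgue = unit_circle"
    by (rule circle_prob_space[OF circle_prob_lebesgue])
  have "emeasure (partial N) (space (partial N))
      = (\<integral>\<^sup>+z. ennreal (\<Prod>k=1..N. P k (z ^ a k)) * indicator (space circle_lebesgue) z \<partial>circle_lebesgue)"
    unfolding partial_def
    by (subst emeasure_density[OF measurable_compose[OF measurable_on_circle[OF prod_continuous
          sets_lebesgue] measurable_ennreal]]) auto
  also have "\<dots> = (\<integral>\<^sup>+z. ennreal (\<Prod>k=1..N. P k (z ^ a k)) \<partial>circle_lebesgue)"
    by (intro nn_integral_cong) auto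
  also have "\<dots> = ennreal (\<integral>z. (\<Prod>k=1..N. P k (z ^ a k)) \<partial>circle_lebesgue)"
    using prod_nonneg_circle
    by (intro nn_integral_eq_integral integrable_on_circle[OF circle_prob_lebesgue] prod_continuous)
       (auto simp: sp)
  finally have "emeasure (partial N) (space (partial N)) = 1"
    by (simp only: int ennreal_1)
  then show ?thesis
    unfolding circle_prob_def using sets_lebesgue
    by (auto intro: prob_spaceI simp: partial_def)
qed

text \<open>Frequencies grow without bound, so by stability every coefficient is eventually constant
  in N, and its final value is the coefficient of the limit.\<close>

lemma limit_exists:
  obtains \<sigma> where "generalized_riesz_product \<sigma>"
    "\<And>N m. 2 * \<bar>m\<bar> \<le> int (a (Suc N)) \<Longrightarrow> fourier_coeff \<sigma> m = fourier_coeff (partial N) m"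
proof -
  have ev: "(\<lambda>N'. fourier_coeff (partial N') m) \<longlonglongrightarrow> fourier_coeff (partial N) m"
    if "2 * \<bar>m\<bar> \<le> int (a (Suc N))" for N m
    using fourier_coeff_partial_stable[OF _ that]
    by (intro tendsto_eventually eventually_sequentiallyI) blast
  have conv: "convergent (\<lambda>N. fourier_coeff (partial N) m)" for m
  proof -
    have "2 * \<bar>m\<bar> \<le> int (a (Suc (nat (2 * \<bar>m\<bar>))))"
      using a_ge[of "nat (2 * \<bar>m\<bar>)"] by linarith
    from ev[OF this] show ?thesis by (auto simp: convergent_def)
  qed
  obtain \<sigma> where \<sigma>: "circle_prob \<sigma>" "weak_star_limit partial \<sigma>"
    and lim: "\<And>n. (\<lambda>N. fourier_coeff (partial N) n) \<longlonglongrightarrow> fourier_coeff \<sigma> n"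
    using weak_star_limit_exists[of partial] circle_prob_partial conv by metis
  have int: "(\<integral>z. P k z \<partial>circle_lebesgue) = 1" if k: "1 \<le> k" for k
  proof -
    have "complex_of_real (\<integral>z. P k z \<partial>circle_lebesgue) = (\<integral>z. of_real (P k z) \<partial>circle_lebesgue)"
      by (rule integral_complex_of_real[symmetric])
    also have "\<dots> = (\<integral>z. (\<Sum>t=-int (d k)..int (d k). c k t * z powi t) \<partial>circle_lebesgue)"
      using expand[OF k] circle_prob_space[OF circle_prob_lebesgue]
      by (intro Bochner_Integration.integral_cong) auto
    also have "\<dots> = (\<Sum>t=-int (d k)..int (d k). c k t * fourier_coeff circle_lebesgue t)"
      unfolding fourier_coeff_def
      by (subst Bochner_Integration.integral_sum)
         (auto intro!: integrable_on_circle[OF circle_prob_lebesgue] continuous_intros)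
    also have "\<dots> = (\<Sum>t=-int (d k)..int (d k). if t = 0 then c k t else 0)"
      by (intro sum.cong) (auto simp: fourier_coeff_lebesgue)
    also have "\<dots> = 1"
      using coeff_0[OF k] by simp
    finally show ?thesis unfolding of_real_eq_1_iff .
  qed
  have tp: "trig_poly (d k) (P k)" if "1 \<le> k" for k
    unfolding trig_poly_def using expand[OF that] by blast
  have "generalized_riesz_product \<sigma>"
    unfolding generalized_riesz_product_def
    using \<sigma> tp int nonneg a_mono a_pos dissociated
    by (intro conjI exI[of _ P] exI[of _ d] exI[of _ a]) (auto simp: partial_def[abs_def])
  then show ?thesis
    using that ev lim LIMSEQ_unique by blast
qed

text \<open>Peel off the top digit repeatedly. The hypothesis keeps the remaining sum within half of
  the next frequency, where dissociation isolates a single term.\<close>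

lemma fourier_coeff_partial_sum:
  fixes s :: "nat \<Rightarrow> int"
  assumes "\<And>k. k < N \<Longrightarrow> 2 * \<bar>\<Sum>j=1..k. s j * int (a j)\<bar> \<le> int (a (Suc k))"
  shows "fourier_coeff (partial N) (\<Sum>j=1..N. s j * int (a j)) = (\<Prod>j=1..N. c j (- s j))"
  using assms
proof (induction N)
  case (Suc N)
  then show ?case
    using fourier_coeff_partial_Suc_eq[of "\<Sum>j=1..N. s j * int (a j)" N "s (Suc N)"] by simp
qed (simp add: fourier_coeff_partial_0)

end

section \<open>Lacunary frequencies\<close>

text \<open>The Weierstrass product inequality, which lets the defects of the separate kernels add
  up.\<close>

lemma one_minus_sum_le_prod:
  fixes x :: "'a \<Rightarrow> real"
  assumes "\<And>i. i \<in> A \<Longrightarrow> 0 \<le> x i" "\<And>i. i \<in> A \<Longrightarrow> x i \<le> 1"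
  shows "1 - (\<Sum>i\<in>A. 1 - x i) \<le> (\<Prod>i\<in>A. x i)"
  using assms
proof (induction A rule: infinite_finite_induct)
  case (insert i A)
  have "(1 - x i) * (\<Prod>i\<in>A. x i) \<le> (1 - x i) * 1"
    using insert.prems by (intro mult_left_mono prod_le_1) auto
  moreover have "1 - (\<Sum>i\<in>A. 1 - x i) \<le> (\<Prod>i\<in>A. x i)"
    using insert.prems by (intro insert.IH) auto
  ultimately show ?case
    using insert.hyps by (simp add: algebra_simps)
qed auto

text \<open>Here x is about X / 2, while y is at most c / 2 <= X / 64. In the application X / 8
  bounds the degree of a partial product, and up to X / 2 that product has the coefficients of the
  limit, so the difference falls into a spectral gap.\<close>

lemma half_difference_bounds:
  fixes x y X Y c :: int
  assumes "2 * x \<le> X" "X \<le> 2 * x + 1" "2 * y \<le> Y" "0 \<le> y" "Y \<le> c" "32 * c \<le> X" "0 < c"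
  shows "2 * \<bar>x - y\<bar> \<le> X" "X < 8 * \<bar>x - y\<bar>"
proof -
  have yc: "2 * y \<le> c" using assms(3,5) by linarith
  have xc: "31 * c \<le> 2 * x" using assms(2,6,7) by linarith
  have "y \<le> x" using yc xc assms(7) by linarith
  moreover have "2 * (x - y) \<le> X" using assms(1,4) by simp
  moreover have "X < 8 * x - 8 * y" using assms(2,7) xc yc by linarith
  ultimately show "2 * \<bar>x - y\<bar> \<le> X" "X < 8 * \<bar>x - y\<bar>" by simp_all
qed

text \<open>The constant is \<open>9 * 64\<^sup>2\<close>: the tents have half-width \<open>M\<^sub>k = \<lfloor>b\<^bsub>k+1\<^esub> / (32 b\<^sub>k)\<rfloor> \<ge> b\<^bsub>k+1\<^esub> / (64 b\<^sub>k)\<close>.\<close>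

lemma exists_riesz_product_lacunary:
  fixes b :: "nat \<Rightarrow> nat"
  assumes b_pos: "\<And>k. 1 \<le> k \<Longrightarrow> 0 < b k"
    and lac: "\<And>k. 1 \<le> k \<Longrightarrow> 32 * b k \<le> b (Suc k)"
  shows "\<exists>\<sigma>. generalized_riesz_product \<sigma> \<and> continuous_measure \<sigma> \<and>
    (\<forall>(s :: nat \<Rightarrow> int) N.
       (\<forall>j. 1 \<le> j \<longrightarrow> j \<le> N \<longrightarrow> 0 \<le> s j \<and> 32 * (s j * int (b j)) \<le> int (b (Suc j))) \<longrightarrow>
       norm (fourier_coeff \<sigma> (\<Sum>j=1..N. s j * int (b j)) - 1)
         \<le> 36864 * (\<Sum>j=1..N. (real_of_int (s j * int (b j)) / real (b (Suc j)))\<^sup>2))"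
proof -
  define M where "M k = b (Suc k) div (32 * b k)" for k
  have M_pos: "0 < M k" if "1 \<le> k" for k
    using lac[OF that] b_pos[OF that] by (simp add: M_def div_greater_zero_iff)
  have M_le: "32 * (M k * b k) \<le> b (Suc k)" for k
    using div_times_less_eq_dividend[of "b (Suc k)" "32 * b k"] by (simp add: M_def mult_ac)
  \<comment> \<open>Rounding down loses at most a factor 2, because the quotient is at least
    1.\<close>
  have M_ge: "real (b (Suc k)) \<le> 64 * (real (M k) * real (b k))" if "1 \<le> k" for k
  proof -
    have "b (Suc k) < 32 * b k + 32 * b k * M k"
      using dividend_less_times_div[of "32 * b k" "b (Suc k)"] b_pos[OF that] by (simp add: M_def)
    also have "\<dots> \<le> 64 * (M k * b k)"
      using M_pos[OF that] by (cases "M k") auto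
    finally have "real (b (Suc k)) \<le> real (64 * (M k * b k))"
      by (simp only: of_nat_le_iff less_imp_le)
    then show ?thesis by simp
  qed
  have b_less: "b k < b (Suc k)" if "1 \<le> k" for k
    using lac[OF that] b_pos[OF that] by linarith
  have b_mono: "b i \<le> b j" if "1 \<le> i" "i \<le> j" for i j
    using that(2)
  proof (induction rule: dec_induct)
    case (step k)
    then show ?case using b_less[of k] that(1) by simp
  qed simp
  define d where "d k = 2 * M k" for k
  \<comment> \<open>Stronger than dissociation: the spectrum up to stage N stays within an eighth of
    the next frequency. This opens the gap between one eighth and one half used against
    atoms.\<close>
  have deg: "8 * (\<Sum>j=1..N. int (d j) * int (b j)) \<le> int (b (Suc N))" for N
  proof (induction N)
    case (Suc N)
    have "16 * (int (d (Suc N)) * int (b (Suc N))) = int (32 * (M (Suc N) * b (Suc N)))"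
      by (simp add: d_def)
    also have "\<dots> \<le> int (b (Suc (Suc N)))"
      using M_le[of "Suc N"] by (simp only: of_nat_le_iff)
    finally show ?case
      using Suc lac[of "Suc N"] by simp
  qed simp
  interpret R: riesz_product "\<lambda>k. tent_kernel (M k)" d b "\<lambda>k t. of_real (tent_corr (M k) t)"
  proof
    show "strict_mono_on {1..} b"
    proof (rule strict_mono_onI)
      fix i j :: nat assume "i \<in> {1..}" "i < j"
      then show "b i < b j"
        using b_less[of i] b_mono[of "Suc i" j] by simp
    qed
    show "1 \<le> int (b (k + 1)) - 2 * (\<Sum>j=1..k. int (d j) * int (b j))" if "1 \<le> k" for k
      using deg[of k] b_pos[of "Suc k"] by simp
  qed (use b_pos M_pos in \<open>auto simp: d_def tent_kernel_expand tent_kernel_nonneg tent_corr_0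
      tent_corr_vanish\<close>)
  obtain \<sigma> where \<sigma>: "generalized_riesz_product \<sigma>"
    and coeff: "\<And>N m. 2 * \<bar>m\<bar> \<le> int (b (Suc N)) \<Longrightarrow> fourier_coeff \<sigma> m = fourier_coeff (R.partial N) m"
    using R.limit_exists by blast
  have prob: "circle_prob \<sigma>"
    using \<sigma> by (simp add: generalized_riesz_product_def)
  \<comment> \<open>The half frequencies start at \<open>b 2\<close>, so the frequency
    \<open>b (Suc i)\<close> preceding the i-th one always has a positive index.\<close>
  have cont: "continuous_measure \<sigma>"
  proof (rule continuous_measure_if_orthogonal_characters[OF prob, where u = "\<lambda>i. int (b (Suc (Suc i)) div 2)"])
    fix i j :: nat assume ij: "j < i"
    let ?u = "\<lambda>i. int (b (Suc (Suc i)) div 2)"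
    have "b (Suc (Suc j)) \<le> b (Suc i)"
      using ij by (intro b_mono) auto
    then have le: "int (b (Suc (Suc j))) \<le> int (b (Suc i))"
      by (simp only: of_nat_le_iff)
    have lac': "32 * int (b (Suc i)) \<le> int (b (Suc (Suc i)))" "0 < int (b (Suc i))"
      using lac[of "Suc i"] b_pos[of "Suc i"] by simp_all
    have half: "2 * ?u k \<le> int (b (Suc (Suc k)))" "int (b (Suc (Suc k))) \<le> 2 * ?u k + 1" for k
      by linarith+
    note m = half_difference_bounds[OF half(1) half(2) half(1) of_nat_0_le_iff le lac']
    have "R.degree_bound (Suc i) < \<bar>?u i - ?u j\<bar>"
      using le_less_trans[OF deg[of "Suc i"] m(2)] unfolding R.degree_bound_def
      by (simp only: mult_less_cancel_left_pos zero_less_numeral)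
    then have zero: "fourier_coeff \<sigma> k = 0" if "\<bar>k\<bar> = \<bar>?u i - ?u j\<bar>" for k
      using m(1) R.fourier_coeff_partial_vanish[of "Suc i" k] coeff[of k "Suc i"]
      unfolding that[symmetric] by simp
    show "fourier_coeff \<sigma> (?u i - ?u j) = 0 \<and> fourier_coeff \<sigma> (?u j - ?u i) = 0"
      using zero[OF refl] zero[OF abs_minus_commute] by blast
  qed
  have "norm (fourier_coeff \<sigma> (\<Sum>j=1..N. s j * int (b j)) - 1)
         \<le> 36864 * (\<Sum>j=1..N. (real_of_int (s j * int (b j)) / real (b (Suc j)))\<^sup>2)"
    if s: "\<And>j. 1 \<le> j \<Longrightarrow> j \<le> N \<Longrightarrow> 0 \<le> s j \<and> 32 * (s j * int (b j)) \<le> int (b (Suc j))"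
    for s :: "nat \<Rightarrow> int" and N
  proof -
    have sum_nn: "0 \<le> (\<Sum>j=1..k. s j * int (b j))" if "k \<le> N" for k
      using s that by (intro sum_nonneg mult_nonneg_nonneg) auto
    have sum_le: "16 * (\<Sum>j=1..k. s j * int (b j)) \<le> int (b (Suc k))" if "k \<le> N" for k
      using that
    proof (induction k)
      case (Suc k)
      then show ?case
        using s[of "Suc k"] lac[of "Suc k"] by simp
    qed simp
    \<comment> \<open>Half of the next frequency is the range both for peeling off digits and for
      identifying coefficients of \<open>\<sigma>\<close> with those of a partial product.\<close>
    have small: "2 * \<bar>\<Sum>j=1..k. s j * int (b j)\<bar> \<le> int (b (Suc k))" if "k \<le> N" for k
      using sum_nn[OF that] sum_le[OF that] by linarith
    let ?c = "\<lambda>j. tent_corr (M j) (- s j)"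
    have c: "0 \<le> ?c j" "?c j \<le> 1" if "j \<in> {1..N}" for j
      using that M_pos[of j] by (auto simp: tent_corr_nonneg tent_corr_bounds)
    have "fourier_coeff \<sigma> (\<Sum>j=1..N. s j * int (b j)) = of_real (\<Prod>j=1..N. ?c j)"
      using coeff[OF small[of N]] R.fourier_coeff_partial_sum[of N s] small by simp
    then have "norm (fourier_coeff \<sigma> (\<Sum>j=1..N. s j * int (b j)) - 1)
        = norm (complex_of_real ((\<Prod>j=1..N. ?c j) - 1))"
      by (simp only: of_real_diff of_real_1)
    also have "\<dots> = 1 - (\<Prod>j=1..N. ?c j)"
      using prod_le_1[of "{1..N}" ?c] c unfolding norm_of_real by auto
    also have "\<dots> \<le> (\<Sum>j=1..N. 1 - ?c j)"
      using one_minus_sum_le_prod[of "{1..N}" ?c] c by simp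
    also have "\<dots> \<le> (\<Sum>j=1..N. 36864 * (real_of_int (s j * int (b j)) / real (b (Suc j)))\<^sup>2)"
    proof (rule sum_mono)
      fix j assume "j \<in> {1..N}"
      then have j: "1 \<le> j" "j \<le> N" by auto
      have "real_of_int (s j) / real (M j) \<le> 64 * (real_of_int (s j * int (b j)) / real (b (Suc j)))"
        using mult_left_mono[OF M_ge[OF j(1)], of "real_of_int (s j)"] s[OF j] M_pos[OF j(1)]
          b_pos[of "Suc j"] by (simp add: field_simps)
      then have "(real_of_int (s j) / real (M j))\<^sup>2
          \<le> (64 * (real_of_int (s j * int (b j)) / real (b (Suc j))))\<^sup>2"
        using s[OF j] by (intro power_mono) auto
      then have "9 * (real_of_int (- s j) / real (M j))\<^sup>2
          \<le> 36864 * (real_of_int (s j * int (b j)) / real (b (Suc j)))\<^sup>2"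
        by (simp only: power_mult_distrib) simp
      then show "1 - ?c j \<le> 36864 * (real_of_int (s j * int (b j)) / real (b (Suc j)))\<^sup>2"
        using tent_corr_bounds(2)[OF M_pos[OF j(1)], of "- s j"] by linarith
    qed
    finally show ?thesis by (simp only: sum_distrib_left)
  qed
  then show ?thesis
    by (intro exI[of _ \<sigma>] conjI \<sigma> cont allI impI) blast
qed

section \<open>From blocks of the sequence to digits along the frequencies\<close>

theorem proposition4p1:
  fixes p :: "nat \<Rightarrow> int" and q :: "nat \<Rightarrow> nat \<Rightarrow> int" and r :: "nat \<Rightarrow> nat"
    and n :: "nat \<Rightarrow> int"
  assumes "strict_mono_on {1..} p"
    and "\<And>l. 1 \<le> l \<Longrightarrow> 0 < p l"
    and "\<And>l. 1 \<le> l \<Longrightarrow> strict_mono_on {0..r l} (\<lambda>j. q j l)"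
    and "\<And>l. 1 \<le> l \<Longrightarrow> q 0 l = 1"
    and "\<And>l. 1 \<le> l \<Longrightarrow> q (r l) l * p l < p (l + 1)"
    and "(\<lambda>l. (real_of_int ((\<Sum>j=0..r l. q j l) * p l) / real_of_int (p (l + 1)))\<^sup>2)
           summable_on {1..}"
    and "strict_mono_on {1..} n"
    and "n ` {1..} = (\<Union>l\<in>{1..}. insert (p l) ((\<lambda>j. q j l * p l) ` {1..r l}))"
  shows "\<exists>\<sigma>. generalized_riesz_product \<sigma> \<and> continuous_measure \<sigma> \<and> ip_dirichlet \<sigma> n"
proof -
  define B where "B l = (\<lambda>j. q j l * p l) ` {0..r l}" for l
  define Q where "Q l = (\<Sum>j=0..r l. q j l)" for l
  define \<epsilon> where "\<epsilon> l = real_of_int (Q l * p l) / real_of_int (p (Suc l))" for l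
  have p_pos: "0 < p l" if "1 \<le> l" for l
    using assms(2) that .
  have p_mono: "p l \<le> p l'" if "1 \<le> l" "l \<le> l'" for l l'
    using assms(1) that by (cases "l = l'") (auto simp: strict_mono_on_def intro!: less_imp_le)
  have q_pos: "1 \<le> q j l" if "1 \<le> l" "j \<le> r l" for j l
    using assms(3)[OF that(1)] assms(4)[OF that(1)] that(2)
    by (cases "j = 0") (force simp: strict_mono_on_def)+
  have q_le: "q j l \<le> q (r l) l" if "1 \<le> l" "j \<le> r l" for j l
    using assms(3)[OF that(1)] that(2)
    by (cases "j = r l") (auto simp: strict_mono_on_def intro!: less_imp_le)
  \<comment> \<open>Block l lies in the interval from p_l to p_{l+1}, right end excluded, so
    distinct blocks are disjoint and ordered by l.\<close>
  have B_bounds: "p l \<le> x" "x < p (Suc l)" "p l dvd x" if l: "1 \<le> l" and x: "x \<in> B l" for l x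
  proof -
    obtain j where j: "j \<le> r l" "x = q j l * p l"
      using x by (auto simp: B_def)
    have "1 * p l \<le> q j l * p l" "q j l * p l \<le> q (r l) l * p l"
      using q_pos q_le p_pos[OF l] l j(1) by (auto intro!: mult_right_mono)
    then show "p l \<le> x" "x < p (Suc l)" "p l dvd x"
      using assms(5)[OF l] j(2) by auto
  qed
  have range_n: "n ` {1..} = (\<Union>l\<in>{1..}. B l)"
  proof -
    have "insert (p l) ((\<lambda>j. q j l * p l) ` {1..r l}) = B l" if "1 \<le> l" for l
    proof -
      have "{0..r l} = insert 0 {1..r l}" by auto
      then show ?thesis using assms(4)[OF that] by (simp add: B_def)
    qed
    then show ?thesis using assms(8) by simp
  qed
  have B_disjoint: "B l \<inter> B l' = {}" if "1 \<le> l" "1 \<le> l'" "l \<noteq> l'" for l l'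
  proof -
    have "B l \<inter> B l' = {}" if "1 \<le> l" "l < l'" for l l'
      using B_bounds[of l] B_bounds[of l'] p_mono[of "Suc l" l'] that by force
    from this[of l l'] this[of l' l] show ?thesis
      using that by (cases l l' rule: linorder_cases) auto
  qed
  \<comment> \<open>Division by p_l recovers the multipliers q_{j,l}, so a subset of a block sums to
    a digit between 0 and q_l times p_l. Bounding over the image by \<open>sum_image_le\<close>
    avoids an injectivity argument.\<close>
  have block_sum: "(\<Sum>x\<in>S. x div p l) \<le> Q l" "0 \<le> (\<Sum>x\<in>S. x div p l)"
    "(\<Sum>x\<in>S. x div p l) * p l = \<Sum>S"
    if l: "1 \<le> l" and S: "S \<subseteq> B l" for l S
  proof -
    have nonneg: "0 \<le> x div p l" if "x \<in> B l" for x
      using B_bounds[OF l that] p_pos[OF l] by (simp add: pos_imp_zdiv_nonneg_iff)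
    have "(\<Sum>x\<in>S. x div p l) \<le> (\<Sum>x\<in>B l. x div p l)"
      using S nonneg by (intro sum_mono2) (auto simp: B_def)
    also have "\<dots> \<le> (\<Sum>j\<in>{0..r l}. q j l * p l div p l)"
      unfolding B_def
    proof (rule sum_image_le[where g = "\<lambda>x. x div p l", unfolded o_def])
      fix j assume "j \<in> {0..r l}"
      then show "0 \<le> q j l * p l div p l"
        using nonneg[of "q j l * p l"] by (auto simp only: B_def)
    qed simp
    also have "\<dots> = Q l"
      using p_pos[OF l] by (simp add: Q_def)
    finally show "(\<Sum>x\<in>S. x div p l) \<le> Q l" .
    show "0 \<le> (\<Sum>x\<in>S. x div p l)"
      using nonneg S by (intro sum_nonneg) auto
    show "(\<Sum>x\<in>S. x div p l) * p l = \<Sum>S"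
      using B_bounds(3)[OF l] S by (auto simp: sum_distrib_right intro!: sum.cong)
  qed
  have Q_pos: "1 \<le> Q l" if "1 \<le> l" for l
  proof -
    have "q 0 l \<le> Q l"
      unfolding Q_def
    proof (rule member_le_sum)
      fix j assume "j \<in> {0..r l} - {0}"
      then show "0 \<le> q j l" using q_pos[OF that, of j] by simp
    qed auto
    then show ?thesis using q_pos[OF that, of 0] by simp
  qed
  have "(\<lambda>l. (\<epsilon> l)\<^sup>2) summable_on {1..}"
    using assms(6) by (simp add: \<epsilon>_def Q_def)
  also have "{1..} = range Suc"
    using Suc_le_D by (auto simp: image_iff)
  finally have "(\<lambda>l. (\<epsilon> (Suc l))\<^sup>2) summable_on UNIV"
    by (subst (asm) summable_on_reindex) (auto simp: o_def)
  then have summ: "summable (\<lambda>l. (\<epsilon> l)\<^sup>2)"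
    using summable_on_imp_summable summable_Suc_iff by blast
  then have "(\<lambda>l. (\<epsilon> l)\<^sup>2) \<longlonglongrightarrow> 0"
    by (rule summable_LIMSEQ_zero)
  then have "eventually (\<lambda>l. (\<epsilon> l)\<^sup>2 < (1 / 32)\<^sup>2) sequentially"
    by (rule order_tendstoD) simp
  \<comment> \<open>Beyond \<open>L\<close> the ratio q_l p_l / p_{l+1} is below 1/32. Since q_l >=
    1, this yields both the lacunarity of the remaining frequencies and the size condition on
    digits.\<close>
  then obtain L where L: "\<And>l. L \<le> l \<Longrightarrow> (\<epsilon> l)\<^sup>2 < (1 / 32)\<^sup>2"
    by (auto simp: eventually_sequentially)
  have Q_small: "32 * (Q l * p l) \<le> p (Suc l)" if l: "1 \<le> l" "L \<le> l" for l
  proof -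
    have "\<epsilon> l < 1 / 32"
      using L[OF l(2)] by (rule power_less_imp_less_base) simp
    then have "32 * real_of_int (Q l * p l) \<le> real_of_int (p (Suc l))"
      using p_pos[of "Suc l"] by (simp add: \<epsilon>_def field_simps)
    then show ?thesis by linarith
  qed
  define b where "b k = nat (p (L + k))" for k
  have b: "int (b k) = p (L + k)" if "1 \<le> k" for k
    using p_pos[of "L + k"] that by (simp add: b_def)
  have b_pos: "0 < b k" if "1 \<le> k" for k
    using p_pos[of "L + k"] that by (simp add: b_def)
  have b_lac: "32 * b k \<le> b (Suc k)" if k: "1 \<le> k" for k
  proof -
    have "1 * p (L + k) \<le> Q (L + k) * p (L + k)"
      using Q_pos[of "L + k"] p_pos[of "L + k"] k by (intro mult_right_mono) auto
    then have "32 * int (b k) \<le> int (b (Suc k))"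
      using Q_small[of "L + k"] k b[of k] b[of "Suc k"] by simp
    then show ?thesis by simp
  qed
  obtain \<sigma> where \<sigma>: "generalized_riesz_product \<sigma>" "continuous_measure \<sigma>"
    and coeff: "\<And>(s :: nat \<Rightarrow> int) N.
       \<forall>j. 1 \<le> j \<longrightarrow> j \<le> N \<longrightarrow> 0 \<le> s j \<and> 32 * (s j * int (b j)) \<le> int (b (Suc j)) \<Longrightarrow>
       norm (fourier_coeff \<sigma> (\<Sum>j=1..N. s j * int (b j)) - 1)
         \<le> 36864 * (\<Sum>j=1..N. (real_of_int (s j * int (b j)) / real (b (Suc j)))\<^sup>2)"
    using exists_riesz_product_lacunary[of b, OF b_pos b_lac] by blast
  have "ip_dirichlet \<sigma> n"
    unfolding ip_dirichlet_def
  proof (intro conjI allI impI)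
    show "circle_prob \<sigma>"
      using \<sigma>(1) by (simp add: generalized_riesz_product_def)
    fix e :: real assume e: "0 < e"
    then have "0 < e / 36864" by simp
    then obtain J where J: "\<And>i k. J \<le> i \<Longrightarrow> norm (\<Sum>l=i..<k. (\<epsilon> l)\<^sup>2) < e / 36864"
      using summ unfolding summable_Cauchy by blast
    \<comment> \<open>Blocks from \<open>\<Lambda>\<close> on correspond, after the shift by
      \<open>L\<close>, to digit positions above \<open>J\<close>, where the tail of the series is
      small.\<close>
    define \<Lambda> where "\<Lambda> = Suc (L + J)"
    have "p \<Lambda> \<in> B \<Lambda>"
      using assms(4)[of \<Lambda>] by (auto simp: B_def \<Lambda>_def intro!: image_eqI[of _ _ 0])
    then have "p \<Lambda> \<in> n ` {1..}"
      unfolding range_n by (auto simp: \<Lambda>_def)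
    \<comment> \<open>The threshold is the index at which the sequence reaches p at
      \<open>\<Lambda>\<close>. Monotonicity then puts every later term into block
      \<open>\<Lambda>\<close> or beyond.\<close>
    then obtain k0 where k0: "1 \<le> k0" "n k0 = p \<Lambda>"
      by auto
    show "\<exists>k0. \<forall>F. finite F \<and> F \<noteq> {} \<and> F \<subseteq> {1..} \<and> k0 \<le> Min F \<longrightarrow>
        norm (fourier_coeff \<sigma> (\<Sum>k\<in>F. n k) - 1) < e"
    proof (intro exI[of _ k0] allI impI)
      fix F assume F: "finite F \<and> F \<noteq> {} \<and> F \<subseteq> {1..} \<and> k0 \<le> Min F"
      define S where "S = n ` F"
      have fin: "finite S" using F by (simp add: S_def)
      have "\<exists>l\<ge>\<Lambda>. x \<in> B l" if "x \<in> S" for x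
      proof -
        obtain k where k: "k \<in> F" "x = n k" using \<open>x \<in> S\<close> by (auto simp: S_def)
        have "k0 \<le> k" using F k(1) Min_le[of F k] by linarith
        then have "p \<Lambda> \<le> x"
          using strict_mono_on_leD[OF assms(7), of k0 k] k0 k(2) by simp
        have "x \<in> n ` {1..}" using k F by auto
        then obtain l where l: "1 \<le> l" "x \<in> B l" unfolding range_n by auto
        have "\<not> l < \<Lambda>"
          using B_bounds(2)[OF l] p_mono[of "Suc l" \<Lambda>] \<open>p \<Lambda> \<le> x\<close> by auto
        then show ?thesis using l(2) by (intro exI[of _ l]) auto
      qed
      then obtain g where g: "\<And>x. x \<in> S \<Longrightarrow> \<Lambda> \<le> g x \<and> x \<in> B (g x)"
        by metis
      define N where "N = Max (insert \<Lambda> (g ` S)) - L"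
      have gN: "g x \<le> L + N" if "x \<in> S" for x
      proof -
        have "g x \<le> Max (insert \<Lambda> (g ` S))"
          using that fin by (intro Max_ge) auto
        then show ?thesis unfolding N_def by linarith
      qed
      have block: "x \<in> B l \<longleftrightarrow> l = g x" if "x \<in> S" "1 \<le> l" for x l
        using g[OF that(1)] B_disjoint[of l "g x"] that(2) by (auto simp: \<Lambda>_def)
      \<comment> \<open>The digit at position j collects all selected terms of block L + j, so the
        sum over F becomes an expansion in the frequencies \<open>b j\<close>.\<close>
      define s where "s j = (\<Sum>x\<in>S \<inter> B (L + j). x div p (L + j))" for j
      have s_mult: "s j * int (b j) = \<Sum>(S \<inter> B (L + j))" if "1 \<le> j" for j
        using block_sum(3)[of "L + j" "S \<inter> B (L + j)"] that b[OF that] by (simp add: s_def)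
      have s_nonneg: "0 \<le> s j" if "1 \<le> j" for j
        using block_sum(2)[of "L + j" "S \<inter> B (L + j)"] that by (simp add: s_def)
      have s_le: "s j * int (b j) \<le> Q (L + j) * p (L + j)" if "1 \<le> j" for j
        using block_sum(1)[of "L + j" "S \<inter> B (L + j)"] that b[OF that]
        by (simp add: s_def mult_right_mono)
      have s_eq_0: "s j = 0" if "1 \<le> j" "j \<le> J" for j
      proof -
        have "S \<inter> B (L + j) = {}"
          using block[of _ "L + j"] g that by (fastforce simp: \<Lambda>_def)
        then show ?thesis by (simp add: s_def)
      qed
      have "(\<Sum>k\<in>F. n k) = \<Sum>S"
        using assms(7) F unfolding S_def
        by (subst sum.reindex) (auto intro: inj_on_subset dest: strict_mono_on_imp_inj_on)
      also have "\<dots> = \<Sum>(\<Union>j\<in>{1..N}. S \<inter> B (L + j))"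
      proof (rule arg_cong[of _ _ "\<lambda>A. \<Sum>A"])
        have "\<exists>j\<in>{1..N}. x \<in> B (L + j)" if "x \<in> S" for x
          using g[OF that] gN[OF that] by (intro bexI[of _ "g x - L"]) (auto simp: \<Lambda>_def)
        then show "S = (\<Union>j\<in>{1..N}. S \<inter> B (L + j))" by auto
      qed
      also have "\<dots> = (\<Sum>j=1..N. \<Sum>(S \<inter> B (L + j)))"
      proof (intro sum.UNION_disjoint ballI impI)
        fix i j assume "i \<in> {1..N}" "j \<in> {1..N}" "i \<noteq> j"
        then show "S \<inter> B (L + i) \<inter> (S \<inter> B (L + j)) = {}"
          using B_disjoint[of "L + i" "L + j"] by auto
      qed (use fin in auto)
      also have "\<dots> = (\<Sum>j=1..N. s j * int (b j))"
        using s_mult by (intro sum.cong) auto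
      finally have sum_eq: "(\<Sum>k\<in>F. n k) = (\<Sum>j=1..N. s j * int (b j))" .
      have "norm (fourier_coeff \<sigma> (\<Sum>k\<in>F. n k) - 1)
         \<le> 36864 * (\<Sum>j=1..N. (real_of_int (s j * int (b j)) / real (b (Suc j)))\<^sup>2)"
        unfolding sum_eq
      proof (rule coeff, intro allI impI conjI)
        fix j :: nat assume j: "1 \<le> j"
        show "0 \<le> s j" using s_nonneg[OF j] .
        show "32 * (s j * int (b j)) \<le> int (b (Suc j))"
          using s_le[OF j] Q_small[of "L + j"] j b[of "Suc j"] by simp
      qed
      \<comment> \<open>Digits up to position \<open>J\<close> vanish, so only a tail of the
        convergent series remains.\<close>
      also have "(\<Sum>j=1..N. (real_of_int (s j * int (b j)) / real (b (Suc j)))\<^sup>2)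
          \<le> (\<Sum>j=1..N. if J < j then (\<epsilon> (L + j))\<^sup>2 else 0)"
      proof (rule sum_mono)
        fix j assume "j \<in> {1..N}"
        then have j: "1 \<le> j" by simp
        have "real (b (Suc j)) = real_of_int (p (Suc (L + j)))"
          using b[of "Suc j"] by (metis add_Suc_right le_add1 of_int_of_nat_eq plus_1_eq_Suc)
        moreover have "0 \<le> s j * int (b j)" using s_nonneg[OF j] by simp
        ultimately have "(real_of_int (s j * int (b j)) / real (b (Suc j)))\<^sup>2 \<le> (\<epsilon> (L + j))\<^sup>2"
          unfolding \<epsilon>_def using s_le[OF j] p_pos[of "Suc (L + j)"]
          by (intro power_mono) (auto intro!: divide_right_mono simp flip: of_int_mult)
        then show "(real_of_int (s j * int (b j)) / real (b (Suc j)))\<^sup>2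
            \<le> (if J < j then (\<epsilon> (L + j))\<^sup>2 else 0)"
          using s_eq_0[OF j] by auto
      qed
      also have "(\<Sum>j=1..N. if J < j then (\<epsilon> (L + j))\<^sup>2 else 0) = (\<Sum>j=Suc J..<Suc N. (\<epsilon> (L + j))\<^sup>2)"
        by (intro sum.mono_neutral_cong_right) auto
      also have "\<dots> = (\<Sum>l=Suc J + L..<Suc N + L. (\<epsilon> l)\<^sup>2)"
        by (subst sum.shift_bounds_nat_ivl) (simp add: add.commute)
      also have "\<dots> < e / 36864"
        using J[of "Suc J + L" "Suc N + L"] by simp
      finally show "norm (fourier_coeff \<sigma> (\<Sum>k\<in>F. n k) - 1) < e"
        by simp
    qed
  qed
  then show ?thesis using \<sigma> by blast
qed

end
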